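(* Let $m\geq 2$ be an integer. For every $a\in(0,\frac1m)\setminus\{\frac1{2m}\}$, both $(f_a,\mathrm{Leb})$ (where $\mathrm{Leb}$ is the Lebesgue measure on $[0,1]^2$) and $(g_a,\mathrm{Leb})$ (where $\mathrm{Leb}$ is the Lebesgue measure on $[0,1]^3$) are exponentially mixing.
   Context: Heterochaos baker maps. Let $m\ge2$ be an integer. For $a\in(0,\frac1m)$ define $\tau_a\colon[0,1]\to[0,1]$ by $\tau_a(x)=\frac{x-(i-1)a}{a}$ on $[(i-1)a,ia)$ for $i\in\{1,\dots,m\}$, and $\tau_a(x)=\frac{x-ma}{1-ma}$ on $[ma,1]$. Put $\Omega_{\alpha_i}^+=[(i-1)a,ia)\times[0,1]$ for $i\in\{1,\dots,m\}$; $\Omega_{\beta_i}^+=[ma,1]\times[\frac{i-1}{m},\frac im)$ for $i\in\{1,\dots,m-1\}$ and $\Omega_{\beta_m}^+=[ma,1]\times[\frac{m-1}{m},1]$. Define $f_a\colon[0,1]^2\to[0,1]^2$ by $f_a(x,y)=(\tau_a(x),\frac ym+\frac{i-1}{m})$ on $\Omega_{\alpha_i}^+$ and $f_a(x,y)=(\tau_a(x),my-i+1)$ on $\Omega_{\beta_i}^+$. Put $\Omega_{\alpha_i}=\Omega_{\alpha_i}^+\times[0,1]$, $\Omega_{\beta_i}=\Omega_{\beta_i}^+\times[0,1]$. For $a,b\in(0,\frac1m)$ define $f_{a,b}\colon[0,1]^3\to[0,1]^3$ by $f_{a,b}(x,y,z)=(f_a(x,y),(1-mb)z)$ on $\Omega_{\alpha_i}$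 and $f_{a,b}(x,y,z)=(f_a(x,y),bz+1+b(i-m-1))$ on $\Omega_{\beta_i}$. Put $g_a=f_{a,\frac1m-a}$. The maps $f_a$ and $g_a$ preserve the Lebesgue measure on $[0,1]^2$ and $[0,1]^3$ respectively. Exponential mixing. Let $X$ be a metric space, $\nu$ a Borel probability measure on $X$ and $T\colon X\to X$ a measurable map preserving $\nu$. For real-valued $\varphi,\psi\in L^2(\nu)$ and $n\ge1$ put $\mathrm{Cor}_n(T;\varphi,\psi;\nu)=\left|\int\varphi(\psi\circ T^n)\,d\nu-\int\varphi\,d\nu\int\psi\,d\nu\right|$. For $\eta\in(0,1]$ let $\mathscr H_\eta(X)$ be the set of real-valued Hölder continuous functions on $X$ with exponent $\eta$. $(T,\nu)$ is exponentially mixing if for each $\eta\in(0,1]$ there exists $\lambda=\lambda(\eta)\in(0,1)$ such that for any pair $\varphi,\psi\in\mathscr H_\eta(X)$ there exists $C=C(\varphi,\psi)>0$ such that $\mathrm{Cor}_n(T;\varphi,\psi;\nu)\le C\lambda^n$ for all $n\ge1$. *)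

theory Defs
  imports "HOL-Probability.Probability"
begin

section \<open>Heterochaos baker maps\<close>

text \<open>
  All maps are total functions of which only the restriction to the unit square or unit cube
  matters.  The unit cube is represented as (unit square) \<open>\<times>\<close> (unit interval), with points
  \<open>((x, y), z)\<close>; the product metric on this type is the Euclidean one and \<open>lborel\<close> on it is
  three-dimensional Lebesgue measure.
\<close>

definition unit_square :: "(real \<times> real) set" where
  "unit_square = {0..1} \<times> {0..1}"

definition unit_cube :: "((real \<times> real) \<times> real) set" where
  "unit_cube = unit_square \<times> {0..1}"

definition tau :: "nat \<Rightarrow> real \<Rightarrow> real \<Rightarrow> real" where
  "tau m a x =
     (if \<exists>i\<in>{1..m}. x \<in> {(real i - 1) * a..<real i * a}
      then let i = (THE i. i \<in> {1..m} \<and> x \<in> {(real i - 1) * a..<real i * a})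
           in (x - (real i - 1) * a) / a
      else (x - real m * a) / (1 - real m * a))"

definition Omega_alpha_plus :: "real \<Rightarrow> nat \<Rightarrow> (real \<times> real) set" where
  "Omega_alpha_plus a i = {(real i - 1) * a..<real i * a} \<times> {0..1}"

definition Omega_beta_plus :: "nat \<Rightarrow> real \<Rightarrow> nat \<Rightarrow> (real \<times> real) set" where
  "Omega_beta_plus m a i =
     {real m * a..1} \<times>
     (if i = m then {(real m - 1) / real m..1} else {(real i - 1) / real m..<real i / real m})"

definition baker_f :: "nat \<Rightarrow> real \<Rightarrow> real \<times> real \<Rightarrow> real \<times> real" where
  "baker_f m a = (\<lambda>(x, y).
     if \<exists>i\<in>{1..m}. (x, y) \<in> Omega_alpha_plus a i
     then let i = (THE i. i \<in> {1..m} \<and> (x, y) \<in> Omega_alpha_plus a i)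
          in (tau m a x, y / real m + (real i - 1) / real m)
     else let i = (THE i. i \<in> {1..m} \<and> (x, y) \<in> Omega_beta_plus m a i)
          in (tau m a x, real m * y - real i + 1))"

definition Omega_alpha :: "real \<Rightarrow> nat \<Rightarrow> ((real \<times> real) \<times> real) set" where
  "Omega_alpha a i = Omega_alpha_plus a i \<times> {0..1}"

definition Omega_beta :: "nat \<Rightarrow> real \<Rightarrow> nat \<Rightarrow> ((real \<times> real) \<times> real) set" where
  "Omega_beta m a i = Omega_beta_plus m a i \<times> {0..1}"

definition baker_fab ::
    "nat \<Rightarrow> real \<Rightarrow> real \<Rightarrow> (real \<times> real) \<times> real \<Rightarrow> (real \<times> real) \<times> real" where
  "baker_fab m a b = (\<lambda>(p, z).
     if \<exists>i\<in>{1..m}. (p, z) \<in> Omega_alpha a i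
     then (baker_f m a p, (1 - real m * b) * z)
     else let i = (THE i. i \<in> {1..m} \<and> (p, z) \<in> Omega_beta m a i)
          in (baker_f m a p, b * z + 1 + b * (real i - real m - 1)))"

definition baker_g :: "nat \<Rightarrow> real \<Rightarrow> (real \<times> real) \<times> real \<Rightarrow> (real \<times> real) \<times> real" where
  "baker_g m a = baker_fab m a (1 / real m - a)"

subsection \<open>The defining equations on the pieces of the partition\<close>

lemma alpha_interval_unique:
  fixes a x :: real and i j :: nat
  assumes "0 < a" "x \<in> {(real i - 1) * a..<real i * a}" "x \<in> {(real j - 1) * a..<real j * a}"
  shows "i = j"
proof -
  have "(real i - 1) * a < real j * a" and "(real j - 1) * a < real i * a"
    using assms(2,3) unfolding atLeastLessThan_iff by linarith+
  then have "real i - 1 < real j" "real j - 1 < real i"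
    using \<open>0 < a\<close> by (metis mult_less_cancel_right_pos)+
  then show ?thesis by linarith
qed

lemma beta_unique:
  fixes i j :: nat
  assumes "i \<in> {1..m}" "j \<in> {1..m}" "p \<in> Omega_beta_plus m a i" "p \<in> Omega_beta_plus m a j"
  shows "i = j"
proof -
  have m: "0 < real m" using assms by auto
  have less: "snd p < real k / real m" if "p \<in> Omega_beta_plus m a k" "k \<noteq> m" for k
    using that by (auto simp: Omega_beta_plus_def)
  have ge: "(real k - 1) / real m \<le> snd p" if "p \<in> Omega_beta_plus m a k" for k
    using that by (auto simp: Omega_beta_plus_def split: if_splits)
  have le: "l \<le> k"
    if "k \<in> {1..m}" "l \<in> {1..m}" "p \<in> Omega_beta_plus m a k" "p \<in> Omega_beta_plus m a l" for k l
  proof (cases "k = m")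
    case False
    have "(real l - 1) / real m < real k / real m"
      using less[OF that(3) False] ge[OF that(4)] by linarith
    then have "real l - 1 < real k" using m by (simp add: divide_less_cancel)
    then show ?thesis by linarith
  qed (use that in auto)
  show ?thesis using le[of i j] le[of j i] assms by simp
qed

lemma alpha_left_of:
  assumes "0 < a" "i \<in> {1..m}" "x \<in> {(real i - 1) * a..<real i * a}"
  shows "x < real m * a"
proof -
  have "real i * a \<le> real m * a" using assms by (intro mult_right_mono) auto
  then show ?thesis using assms(3) unfolding atLeastLessThan_iff by linarith
qed

lemma tau_alpha:
  assumes "0 < a" "i \<in> {1..m}" "x \<in> {(real i - 1) * a..<real i * a}"
  shows "tau m a x = (x - (real i - 1) * a) / a"
proof -
  have "(THE i. i \<in> {1..m} \<and> x \<in> {(real i - 1) * a..<real i * a}) = i"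
    using assms(2,3) alpha_interval_unique[OF assms(1) _ assms(3)]
    by (intro the_equality) blast+
  then show ?thesis using assms(2,3) unfolding tau_def Let_def by (metis (lifting))
qed

lemma tau_beta:
  assumes "0 < a" "x \<in> {real m * a..1}"
  shows "tau m a x = (x - real m * a) / (1 - real m * a)"
proof -
  have "\<not> (\<exists>i\<in>{1..m}. x \<in> {(real i - 1) * a..<real i * a})"
    using alpha_left_of[OF assms(1)] assms(2) by (metis atLeastAtMost_iff linorder_not_less)
  then show ?thesis unfolding tau_def by (simp only: if_False)
qed

lemma Omega_beta_plus_not_alpha:
  assumes "0 < a" "p \<in> Omega_beta_plus m a j"
  shows "\<not> (\<exists>i\<in>{1..m}. p \<in> Omega_alpha_plus a i)"
proof
  assume "\<exists>i\<in>{1..m}. p \<in> Omega_alpha_plus a i"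
  then obtain i where "i \<in> {1..m}" "fst p \<in> {(real i - 1) * a..<real i * a}"
    unfolding Omega_alpha_plus_def by auto
  from alpha_left_of[OF assms(1) this] assms(2) show False
    by (auto simp: Omega_beta_plus_def)
qed

lemma baker_f_alpha:
  assumes "0 < a" "i \<in> {1..m}" "(x, y) \<in> Omega_alpha_plus a i"
  shows "baker_f m a (x, y) = (tau m a x, y / real m + (real i - 1) / real m)"
proof -
  have "j = i" if "(x, y) \<in> Omega_alpha_plus a j" for j
    using alpha_interval_unique[OF assms(1)] that assms(3) unfolding Omega_alpha_plus_def by blast
  then have "(THE i. i \<in> {1..m} \<and> (x, y) \<in> Omega_alpha_plus a i) = i"
    using assms(2,3) by (intro the_equality) blast+
  moreover have "\<exists>i\<in>{1..m}. (x, y) \<in> Omega_alpha_plus a i" using assms by blast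
  ultimately show ?thesis unfolding baker_f_def Let_def by simp
qed

lemma baker_f_beta:
  assumes "0 < a" "i \<in> {1..m}" "(x, y) \<in> Omega_beta_plus m a i"
  shows "baker_f m a (x, y) = (tau m a x, real m * y - real i + 1)"
proof -
  have "(THE i. i \<in> {1..m} \<and> (x, y) \<in> Omega_beta_plus m a i) = i"
    using assms beta_unique by (intro the_equality) blast+
  then show ?thesis
    using Omega_beta_plus_not_alpha[OF assms(1,3)] unfolding baker_f_def Let_def by simp
qed

lemma baker_fab_alpha:
  assumes "i \<in> {1..m}" "(p, z) \<in> Omega_alpha a i"
  shows "baker_fab m a b (p, z) = (baker_f m a p, (1 - real m * b) * z)"
proof -
  have "\<exists>i\<in>{1..m}. (p, z) \<in> Omega_alpha a i" using assms by blast
  then show ?thesis unfolding baker_fab_def by simp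
qed

lemma baker_fab_beta:
  assumes "0 < a" "i \<in> {1..m}" "(p, z) \<in> Omega_beta m a i"
  shows "baker_fab m a b (p, z) = (baker_f m a p, b * z + 1 + b * (real i - real m - 1))"
proof -
  have "(THE i. i \<in> {1..m} \<and> (p, z) \<in> Omega_beta m a i) = i"
    using assms beta_unique unfolding Omega_beta_def by (intro the_equality) blast+
  moreover have "\<not> (\<exists>i\<in>{1..m}. (p, z) \<in> Omega_alpha a i)"
    using Omega_beta_plus_not_alpha[of a p m i] assms
    unfolding Omega_alpha_def Omega_beta_def by blast
  ultimately show ?thesis unfolding baker_fab_def Let_def by simp
qed

section \<open>Exponential mixing\<close>

text \<open>
  A metric space is a subset of a type of class \<open>metric_space\<close>, given as the space of the
  measure \<open>\<nu>\<close>.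
\<close>

definition borel_probability :: "'a::metric_space measure \<Rightarrow> bool" where
  "borel_probability \<nu> \<longleftrightarrow>
     prob_space \<nu> \<and> sets \<nu> = sets (restrict_space borel (space \<nu>))"

definition preserves_measure :: "('a \<Rightarrow> 'a) \<Rightarrow> 'a measure \<Rightarrow> bool" where
  "preserves_measure T \<nu> \<longleftrightarrow> T \<in> \<nu> \<rightarrow>\<^sub>M \<nu> \<and> distr \<nu> \<nu> T = \<nu>"

definition Cor ::
    "nat \<Rightarrow> ('a \<Rightarrow> 'a) \<Rightarrow> ('a \<Rightarrow> real) \<Rightarrow> ('a \<Rightarrow> real) \<Rightarrow> 'a measure \<Rightarrow> real" where
  "Cor n T \<phi> \<psi> \<nu> =
     \<bar>(\<integral>x. \<phi> x * \<psi> ((T ^^ n) x) \<partial>\<nu>) - (\<integral>x. \<phi> x \<partial>\<nu>) * (\<integral>x. \<psi> x \<partial>\<nu>)\<bar>"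

definition Holder :: "real \<Rightarrow> 'a::metric_space set \<Rightarrow> ('a \<Rightarrow> real) set" where
  "Holder \<eta> X =
     {\<phi>. \<exists>K\<ge>0. \<forall>x\<in>X. \<forall>y\<in>X. \<bar>\<phi> x - \<phi> y\<bar> \<le> K * dist x y powr \<eta>}"

definition exponentially_mixing :: "('a::metric_space \<Rightarrow> 'a) \<Rightarrow> 'a measure \<Rightarrow> bool" where
  "exponentially_mixing T \<nu> \<longleftrightarrow>
     borel_probability \<nu> \<and> preserves_measure T \<nu> \<and>
     (\<forall>\<eta>\<in>{0<..1}. \<exists>r\<in>{0<..<1}.
        \<forall>\<phi>\<in>Holder \<eta> (space \<nu>). \<forall>\<psi>\<in>Holder \<eta> (space \<nu>).
          \<exists>C>0. \<forall>n\<ge>1. Cor n T \<phi> \<psi> \<nu> \<le> C * r ^ n)"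

end

theory Submission
  imports Defs
begin

text \<open>
  Put \<open>p = m * a\<close>. The first coordinate is driven by a full-branch expanding map, and
  the base-\<open>m\<close> digits of \<open>y\<close> form a stack on which a symbol \<open>\<alpha>\<close> (probability \<open>p\<close>) pushes a digit
  and \<open>\<beta>\<close> (probability \<open>1 - p\<close>) pops one, so \<open>p \<noteq> 1 / 2\<close> means that the stack height has drift.

  If \<open>p < 1 / 2\<close>, the transfer operator of \<open>f\<close> contracts. Measure the oscillation of a function
  in \<open>y\<close> over digit cylinders of level \<open>N\<close> in units of \<open>\<theta> ^ N\<close>: up to a term controlled by the
  oscillation in \<open>x\<close>, which decays anyway, one application multiplies it by
  \<open>p / \<theta> + (1 - p) * \<theta>\<close>, which is less than 1 for \<open>\<theta> < 1\<close> close to 1. Since \<open>g\<close> contracts \<open>z\<close>, the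
  observable \<open>\<psi> \<circ> g ^ (n div 2)\<close> is almost a function of \<open>(x, y)\<close>, so decay for \<open>f\<close>, which
  requires no regularity of \<open>\<psi>\<close>, gives decay for \<open>g\<close>.

  If \<open>p > 1 / 2\<close>, the inverse of \<open>g\<close> is a map of the same kind with the roles of \<open>x\<close> and \<open>z\<close>
  exchanged and \<open>p\<close> replaced by \<open>1 - p\<close>; this symmetry exchanges \<open>\<phi>\<close> and \<open>\<psi>\<close> in the correlations.
  Finally \<open>f\<close> is a factor of \<open>g\<close>.
\<close>

section \<open>Bounded measurable functions and Lebesgue measure on the cube\<close>

text \<open>The bound is required at every point, not almost everywhere, so the class is closed
  under composition with every measurable map, including restriction to slices such as
  \<open>z = 0\<close>, which are null sets.\<close>

definition bmeas :: "'a measure \<Rightarrow> ('a \<Rightarrow> real) set" where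
  "bmeas M = {f. f \<in> borel_measurable M \<and> (\<exists>B. \<forall>x. \<bar>f x\<bar> \<le> B)}"

lemma bmeas_measurable [measurable_dest]: "f \<in> bmeas M \<Longrightarrow> f \<in> borel_measurable M"
  by (simp add: bmeas_def)

lemma bmeasI: "f \<in> borel_measurable M \<Longrightarrow> (\<And>x. \<bar>f x\<bar> \<le> B) \<Longrightarrow> f \<in> bmeas M"
  by (auto simp: bmeas_def)

lemma bmeas_bound:
  assumes "f \<in> bmeas M"
  obtains B where "B > 0" "\<And>x. \<bar>f x\<bar> \<le> B"
proof -
  from assms obtain B where B: "\<And>x. \<bar>f x\<bar> \<le> B" by (auto simp: bmeas_def)
  have "\<bar>f x\<bar> \<le> \<bar>B\<bar> + 1" for x using B[of x] by linarith
  then show ?thesis using that[of "\<bar>B\<bar> + 1"] by simp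
qed

lemma bmeas_const: "(\<lambda>_. k) \<in> bmeas M"
  by (auto simp: bmeas_def)

lemma bmeas_add:
  assumes "f \<in> bmeas M" "g \<in> bmeas M"
  shows "(\<lambda>x. f x + g x) \<in> bmeas M"
proof -
  obtain B C where "\<And>x. \<bar>f x\<bar> \<le> B" "\<And>x. \<bar>g x\<bar> \<le> C"
    using assms by (metis bmeas_bound)
  then have "\<bar>f x + g x\<bar> \<le> B + C" for x
    by (intro order_trans[OF abs_triangle_ineq] add_mono)
  moreover have "(\<lambda>x. f x + g x) \<in> borel_measurable M"
    using assms by (intro borel_measurable_add bmeas_measurable)
  ultimately show ?thesis by (intro bmeasI)
qed

lemma bmeas_mult:
  assumes "f \<in> bmeas M" "g \<in> bmeas M"
  shows "(\<lambda>x. f x * g x) \<in> bmeas M"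
proof -
  obtain B C where "B > 0" "\<And>x. \<bar>f x\<bar> \<le> B" "\<And>x. \<bar>g x\<bar> \<le> C"
    using assms by (metis bmeas_bound)
  then have "\<bar>f x * g x\<bar> \<le> B * C" for x
    unfolding abs_mult by (intro mult_mono) auto
  moreover have "(\<lambda>x. f x * g x) \<in> borel_measurable M"
    using assms by (intro borel_measurable_times bmeas_measurable)
  ultimately show ?thesis by (intro bmeasI)
qed

lemma bmeas_sum: "(\<And>i. i \<in> I \<Longrightarrow> f i \<in> bmeas M) \<Longrightarrow> (\<lambda>x. \<Sum>i\<in>I. f i x) \<in> bmeas M"
  by (induction I rule: infinite_finite_induct) (auto intro: bmeas_const bmeas_add)

lemma bmeas_comp: "f \<in> bmeas M \<Longrightarrow> h \<in> K \<rightarrow>\<^sub>M M \<Longrightarrow> (\<lambda>x. f (h x)) \<in> bmeas K"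
  by (auto simp: bmeas_def)

lemma (in prob_space) bmeas_integrable: "f \<in> bmeas M \<Longrightarrow> integrable M f"
  unfolding bmeas_def by (force intro: integrable_const_bound)

lemma (in prob_space) abs_expectation_le:
  fixes f :: "'a \<Rightarrow> real"
  assumes "f \<in> borel_measurable M" "AE x in M. \<bar>f x\<bar> \<le> B"
  shows "\<bar>expectation f\<bar> \<le> B"
proof -
  have "integrable M f" by (rule integrable_const_bound[where B=B]) (use assms in auto)
  then show ?thesis
    using assms(2) integral_le_const[of f B] integral_ge_const[of f "-B"]
    by (simp add: abs_le_iff AE_conj_iff minus_le_iff)
qed

lemma (in prob_space) bmeas_partial:
  assumes "f \<in> bmeas (K \<Otimes>\<^sub>M M)"
  shows "(\<lambda>x. \<integral>y. f (x, y) \<partial>M) \<in> bmeas K"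
proof (rule bmeas_bound[OF assms])
  fix B assume B: "B > 0" "\<And>x. \<bar>f x\<bar> \<le> B"
  have [measurable]: "f \<in> borel_measurable (K \<Otimes>\<^sub>M M)" using assms by measurable
  let ?g = "\<lambda>x. \<integral>y. f (x, y) \<partial>M"
  have "\<bar>?g x\<bar> \<le> B" for x
  proof (cases "(\<lambda>y. f (x, y)) \<in> borel_measurable M")
    case True
    then show ?thesis by (rule abs_expectation_le) (use B in auto)
  next
    \<comment> \<open>Outside \<open>space K\<close> the section need not be measurable; its
      integral is then 0 by convention and the bound persists.\<close>
    case False
    then have "?g x = 0" by (metis borel_measurable_integrable not_integrable_integral_eq)
    then show ?thesis using B by simp
  qed
  moreover have "?g \<in> borel_measurable K"
    using borel_measurable_lebesgue_integral[of "\<lambda>x y. f (x, y)" K] assms by simp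
  ultimately show ?thesis by (intro bmeasI)
qed

lemma (in prob_space) bmeas_section:
  assumes "f \<in> bmeas (K \<Otimes>\<^sub>M M)" "x \<in> space K"
  shows "(\<lambda>y. f (x, y)) \<in> bmeas M"
  using assms(2) by (intro bmeas_comp[OF assms(1)]) simp

text \<open>\<open>M\<close> is the mixture of its images under the maps \<open>h s\<close> with weights \<open>w s\<close>.\<close>

definition splits :: "'a measure \<Rightarrow> nat \<Rightarrow> (nat \<Rightarrow> real) \<Rightarrow> (nat \<Rightarrow> 'a \<Rightarrow> 'a) \<Rightarrow> bool" where
  "splits M N w h \<longleftrightarrow> (\<forall>s<N. h s \<in> M \<rightarrow>\<^sub>M M) \<and>
     (\<forall>f\<in>bmeas M. (\<integral>x. f x \<partial>M) = (\<Sum>s<N. w s * (\<integral>x. f (h s x) \<partial>M)))"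

lemma splitsD: "splits M N w h \<Longrightarrow> f \<in> bmeas M \<Longrightarrow>
    (\<integral>x. f x \<partial>M) = (\<Sum>s<N. w s * (\<integral>x. f (h s x) \<partial>M))"
  by (auto simp: splits_def)

text \<open>Fubini, then the splitting of \<open>M\<close> on each fibre, then Fubini again.\<close>

lemma splits_snd:
  assumes "splits M N w h" "prob_space M" "prob_space K"
  shows "splits (K \<Otimes>\<^sub>M M) N w (\<lambda>s p. (fst p, h s (snd p)))"
proof -
  interpret M: prob_space M by fact
  interpret K: prob_space K by fact
  interpret KM: pair_prob_space K M ..
  have [measurable]: "h s \<in> M \<rightarrow>\<^sub>M M" if "s < N" for s
    using assms that by (auto simp: splits_def)
  have "(\<integral>p. f p \<partial>(K \<Otimes>\<^sub>M M)) = (\<Sum>s<N. w s * (\<integral>p. f (fst p, h s (snd p)) \<partial>(K \<Otimes>\<^sub>M M)))"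
    if f: "f \<in> bmeas (K \<Otimes>\<^sub>M M)" for f
  proof -
    have fs: "(\<lambda>p. f (fst p, h s (snd p))) \<in> bmeas (K \<Otimes>\<^sub>M M)" if "s < N" for s
      using that by (intro bmeas_comp[OF f]) auto
    have "(\<integral>p. f p \<partial>(K \<Otimes>\<^sub>M M)) = (\<integral>x. (\<integral>y. f (x, y) \<partial>M) \<partial>K)"
      using KM.integral_fst'[OF KM.P.bmeas_integrable[OF f]] by simp
    also have "\<dots> = (\<integral>x. (\<Sum>s<N. w s * (\<integral>y. f (x, h s y) \<partial>M)) \<partial>K)"
      by (intro Bochner_Integration.integral_cong refl splitsD[OF assms(1)] M.bmeas_section[OF f])
    also have "\<dots> = (\<Sum>s<N. w s * (\<integral>x. (\<integral>y. f (x, h s y) \<partial>M) \<partial>K))"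
      using M.bmeas_partial[OF fs]
      by (subst Bochner_Integration.integral_sum)
         (auto intro!: integrable_mult_right K.bmeas_integrable)
    also have "\<dots> = (\<Sum>s<N. w s * (\<integral>p. f (fst p, h s (snd p)) \<partial>(K \<Otimes>\<^sub>M M)))"
      using KM.integral_fst'[OF KM.P.bmeas_integrable[OF fs]] by (intro sum.cong) simp_all
    finally show ?thesis .
  qed
  then show ?thesis by (auto simp: splits_def)
qed

lemma splits_fst:
  assumes "splits M N w h" "prob_space M" "prob_space K"
  shows "splits (M \<Otimes>\<^sub>M K) N w (\<lambda>s p. (h s (fst p), snd p))"
proof -
  interpret M: prob_space M by fact
  interpret K: prob_space K by fact
  interpret MK: pair_prob_space M K ..
  have S: "splits (K \<Otimes>\<^sub>M M) N w (\<lambda>s p. (fst p, h s (snd p)))"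
    using assms by (rule splits_snd)
  have h [measurable]: "h s \<in> M \<rightarrow>\<^sub>M M" if "s < N" for s
    using assms that by (auto simp: splits_def)
  have swap: "(\<integral>p. f p \<partial>(M \<Otimes>\<^sub>M K)) = (\<integral>p. f (snd p, fst p) \<partial>(K \<Otimes>\<^sub>M M))"
    if "f \<in> bmeas (M \<Otimes>\<^sub>M K)" for f
    using MK.integral_product_swap[OF bmeas_measurable[OF that]]
    by (simp only: case_prod_beta')
  have "(\<integral>p. f p \<partial>(M \<Otimes>\<^sub>M K)) = (\<Sum>s<N. w s * (\<integral>p. f (h s (fst p), snd p) \<partial>(M \<Otimes>\<^sub>M K)))"
    if f: "f \<in> bmeas (M \<Otimes>\<^sub>M K)" for f
  proof -
    have "(\<lambda>p. f (h s (fst p), snd p)) \<in> bmeas (M \<Otimes>\<^sub>M K)" if "s < N" for s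
      using that by (intro bmeas_comp[OF f]) auto
    moreover have "(\<lambda>p. f (snd p, fst p)) \<in> bmeas (K \<Otimes>\<^sub>M M)"
      by (intro bmeas_comp[OF f]) auto
    ultimately show ?thesis
      using splitsD[OF S, of "\<lambda>p. f (snd p, fst p)"] by (simp add: swap[OF f] swap)
  qed
  then show ?thesis using h by (auto simp: splits_def)
qed

section \<open>The uniform distribution on the unit interval, square and cube\<close>

text \<open>A density on the whole line instead of a restricted measure: its space is the whole
  type, so total maps need no domain conditions. The restricted measure returns in
  \<open>exponentially_mixingI\<close>.\<close>

definition unif :: "real measure" where "unif = density lborel (indicator {0..1})"
abbreviation "unif2 \<equiv> unif \<Otimes>\<^sub>M unif"
abbreviation "unif3 \<equiv> unif2 \<Otimes>\<^sub>M unif"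

lemma sets_unif [simp, measurable_cong]: "sets unif = sets borel"
  by (simp add: unif_def)
lemma space_unif [simp]: "space unif = UNIV"
  by (simp add: unif_def)

lemma integral_unif:
  fixes f :: "real \<Rightarrow> real"
  shows "f \<in> borel_measurable borel \<Longrightarrow> (\<integral>x. f x \<partial>unif) = (\<integral>x. indicator {0..1} x * f x \<partial>lborel)"
  unfolding unif_def using integral_density[of f lborel "indicator {0..1}"] by (simp add: ennreal_indicator)

lemma prob_space_unif: "prob_space unif"
  by (rule prob_spaceI) (simp add: unif_def emeasure_density nn_integral_indicator)

interpretation unif: prob_space unif by (rule prob_space_unif)
interpretation unif2: pair_prob_space unif unif ..
interpretation unif3: pair_prob_space unif2 unif ..

lemma sets_unif2: "sets unif2 = sets borel"
  using sets_pair_measure_cong[OF sets_unif sets_unif] by (simp only: borel_prod)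
lemma sets_unif3: "sets unif3 = sets borel"
  using sets_pair_measure_cong[OF sets_unif2 sets_unif] by (simp only: borel_prod)

lemma bmeas_unif3: "bmeas unif3 = bmeas borel"
  unfolding bmeas_def using measurable_cong_sets[OF sets_unif3 refl] by blast

lemma AE_unif: "AE x in unif. x \<in> {0..<1}"
proof -
  have "AE x in lborel. x \<noteq> (1::real)" by (rule AE_lborel_singleton)
  then have "AE x in lborel. 0 < (indicator {0..1::real} x :: ennreal) \<longrightarrow> (x \<in> {0..<1})"
    by (rule eventually_mono) (auto simp: indicator_def)
  then show ?thesis unfolding unif_def by (subst AE_density) auto
qed

text \<open>The map \<open>g\<close> is a bijection of the half-open cube, but not of the closed one.\<close>

definition half_open_cube :: "((real \<times> real) \<times> real) set" where
  "half_open_cube = ({0..<1} \<times> {0..<1}) \<times> {0..<1}"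

lemma AE_unif3: "AE p in unif3. p \<in> half_open_cube"
proof -
  have pair: "AE p in M \<Otimes>\<^sub>M unif. p \<in> A \<times> {0..<1}"
    if "prob_space M" "AE x in M. x \<in> A" "A \<in> sets M" for M :: "'a measure" and A
  proof -
    interpret M: prob_space M by fact
    interpret MU: pair_prob_space M unif ..
    have "AE x in M. AE y in unif. (x, y) \<in> A \<times> {0..<1}"
    proof (rule AE_mp[OF that(2)], rule AE_I2, rule impI)
      fix x assume "x \<in> A"
      then show "AE y in unif. (x, y) \<in> A \<times> {0..<1}"
        using AE_unif by simp
    qed
    moreover have "A \<times> {0..<1} \<in> sets (M \<Otimes>\<^sub>M unif)"
      using that(3) by (intro pair_measureI) simp_all
    then have "{p \<in> space (M \<Otimes>\<^sub>M unif). p \<in> A \<times> {0..<1}} \<in> sets (M \<Otimes>\<^sub>M unif)"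
      by (metis (no_types, lifting) Collect_cong Collect_mem_eq Int_def sets.Int_space_eq1)
    ultimately show ?thesis by (intro MU.AE_pair_measure)
  qed
  show ?thesis
    unfolding half_open_cube_def
    by (intro pair unif2.P.prob_space_axioms prob_space_unif AE_unif pair_measureI) simp_all
qed

section \<open>Baker maps over two partitions of the interval\<close>

text \<open>\<open>br\<close> gives the index of the piece \<open>[c s, c s + l s)\<close>
  containing a point. The pieces partition \<open>[0, 1)\<close> in no prescribed order; apart from
  measurability, \<open>br\<close> is constrained only there.\<close>

locale full_branches =
  fixes N :: nat and br :: "real \<Rightarrow> nat" and c l :: "nat \<Rightarrow> real"
  assumes br_meas [measurable]: "br \<in> borel \<rightarrow>\<^sub>M count_space UNIV"
    and br_less: "x \<in> {0..<1} \<Longrightarrow> br x < N"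
    and len_pos: "s < N \<Longrightarrow> 0 < l s"
    and start_nonneg: "s < N \<Longrightarrow> 0 \<le> c s"
    and end_le: "s < N \<Longrightarrow> c s + l s \<le> 1"
    and br_eq_iff: "s < N \<Longrightarrow> x \<in> {0..<1} \<Longrightarrow> br x = s \<longleftrightarrow> c s \<le> x \<and> x < c s + l s"
begin

lemma inverse_branch:
  assumes "s < N" "t \<in> {0..<1}"
  shows "c s + l s * t \<in> {0..<1}" "br (c s + l s * t) = s"
proof -
  have "0 \<le> l s * t" "l s * t < l s" using len_pos[OF assms(1)] assms(2) by auto
  then show mem: "c s + l s * t \<in> {0..<1}"
    using start_nonneg[OF assms(1)] end_le[OF assms(1)] by simp
  show "br (c s + l s * t) = s"
    using br_eq_iff[OF assms(1) mem] \<open>0 \<le> l s * t\<close> \<open>l s * t < l s\<close> by simp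
qed

lemma branch:
  assumes "x \<in> {0..<1}" "br x = s"
  shows "(x - c s) / l s \<in> {0..<1}"
proof -
  have "s < N" using br_less[OF assms(1)] assms(2) by simp
  then show ?thesis using br_eq_iff[of s x] assms len_pos[of s] by (simp add: field_simps)
qed

text \<open>Law of total probability: piece \<open>s\<close> has probability \<open>l s\<close>, and
  conditioned on it the uniform distribution is its own image under the affine inverse
  branch.\<close>

lemma splits_unif: "splits unif N l (\<lambda>s t. c s + l s * t)"
proof -
  have "(\<integral>x. f x \<partial>unif) = (\<Sum>s<N. l s * (\<integral>t. f (c s + l s * t) \<partial>unif))" if f: "f \<in> bmeas unif" for f
  proof -
    have fm [measurable]: "f \<in> borel_measurable borel"
      using bmeas_measurable[OF f] measurable_cong_sets[OF sets_unif refl] by blast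
    have ind: "indicator {0..<1} x * f x = (\<Sum>s<N. indicator {c s..<c s + l s} x * f x)"
      for x :: real
    proof (cases "x \<in> {0..<1}")
      case True
      have "(\<Sum>s<N. indicator {c s..<c s + l s} x * f x) = (\<Sum>s<N. if br x = s then f x else 0)"
        using br_eq_iff True by (intro sum.cong) (auto simp: indicator_def)
      also have "\<dots> = f x" using br_less[OF True] by simp
      finally show ?thesis using True by simp
    next
      case False
      then have "x \<notin> {c s..<c s + l s}" if "s < N" for s
        using start_nonneg[OF that] end_le[OF that] by auto
      then show ?thesis using False by simp
    qed
    \<comment> \<open>The pieces tile the half-open interval, while the density is that of the
      closed one; they differ by the null set \<open>{1}\<close>.\<close>
    have AE1: "AE x in lborel. x \<noteq> (1::real)" by (rule AE_lborel_singleton)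
    have half: "(\<integral>x. g x \<partial>unif) = (\<integral>x. indicator {0..<1} x * g x \<partial>lborel)"
      if [measurable]: "g \<in> borel_measurable borel" for g :: "real \<Rightarrow> real"
      unfolding integral_unif[OF that]
      by (rule integral_cong_AE) (use AE1 in \<open>auto elim!: eventually_mono simp: indicator_def\<close>)
    have part: "(\<integral>x. indicator {c s..<c s + l s} x * f x \<partial>lborel) =
        l s * (\<integral>t. f (c s + l s * t) \<partial>unif)" if "s < N" for s
    proof -
      have l: "l s > 0" using len_pos that by simp
      have "(\<integral>x. indicator {c s..<c s + l s} x * f x \<partial>lborel) =
         l s * (\<integral>t. indicator {c s..<c s + l s} (c s + l s * t) * f (c s + l s * t) \<partial>lborel)"
        using l lborel_integral_real_affine[of "l s" "\<lambda>x. indicator {c s..<c s + l s} x * f x" "c s"]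
        by simp
      also have "(\<lambda>t. indicator {c s..<c s + l s} (c s + l s * t) * f (c s + l s * t)) =
          (\<lambda>t. indicator {0..<1} t * f (c s + l s * t))"
        using l by (auto simp: indicator_def fun_eq_iff zero_le_mult_iff)
      finally show ?thesis by (subst half) auto
    qed
    have int: "integrable lborel (\<lambda>x. indicator {c s..<c s + l s} x * f x)" if "s < N" for s
    proof -
      obtain B where "\<And>x. \<bar>f x\<bar> \<le> B" using bmeas_bound[OF f] by blast
      then have "set_integrable lborel {c s..<c s + l s} f"
        unfolding set_integrable_def
        using len_pos[OF that] by (intro integrableI_bounded_set_indicator[where B=B]) auto
      then show ?thesis by (simp add: set_integrable_def)
    qed
    have "(\<integral>x. f x \<partial>unif) = (\<integral>x. (\<Sum>s<N. indicator {c s..<c s + l s} x * f x) \<partial>lborel)"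
      unfolding half[OF fm] by (simp only: ind)
    also have "\<dots> = (\<Sum>s<N. l s * (\<integral>t. f (c s + l s * t) \<partial>unif))"
      using int by (subst Bochner_Integration.integral_sum) (simp_all add: part)
    finally show ?thesis .
  qed
  then show ?thesis by (auto simp: splits_def)
qed

end

text \<open>The minimum only matters at \<open>y = 1\<close>, which belongs to the last piece.\<close>

definition digit :: "nat \<Rightarrow> real \<Rightarrow> nat" where
  "digit m y = min (m - 1) (nat \<lfloor>real m * y\<rfloor>)"

lemma digit_less: "m > 0 \<Longrightarrow> digit m y < m"
  by (auto simp: digit_def)

lemma digit_eq_iff:
  assumes "m > 0" "i < m" "y \<in> {0..<1}"
  shows "digit m y = i \<longleftrightarrow> real i / real m \<le> y \<and> y < (real i + 1) / real m"
proof -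
  have y: "0 \<le> real m * y" "real m * y < real m" using assms by auto
  have "\<lfloor>real m * y\<rfloor> < int m" unfolding floor_less_iff using y by simp
  then have "nat \<lfloor>real m * y\<rfloor> \<le> m - 1"
    using assms(1) by linarith
  then have "digit m y = nat \<lfloor>real m * y\<rfloor>" by (simp add: digit_def)
  moreover have "nat \<lfloor>real m * y\<rfloor> = i \<longleftrightarrow> real i \<le> real m * y \<and> real m * y < real i + 1"
  proof -
    have "nat \<lfloor>real m * y\<rfloor> = i \<longleftrightarrow> \<lfloor>real m * y\<rfloor> = int i" using y(1) by linarith
    then show ?thesis by (simp add: floor_eq_iff)
  qed
  ultimately show ?thesis using assms(1) by (simp add: field_simps)
qed

lemma digit_shift:
  assumes "m > 0" "y \<in> {0..<1}"
  shows "real m * y - real (digit m y) \<in> {0..<1}"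
  using digit_eq_iff[of m "digit m y" y] assms digit_less[of m y] by (simp add: field_simps)

lemma digit_measurable [measurable]: "digit m \<in> borel \<rightarrow>\<^sub>M count_space UNIV"
  unfolding digit_def[abs_def] by measurable

lemma full_branches_digit:
  assumes "m > 0"
  shows "full_branches m (digit m) (\<lambda>i. real i / real m) (\<lambda>_. 1 / real m)"
proof
  fix s assume "s < m"
  then have "real s + 1 \<le> real m" by linarith
  then show "real s / real m + 1 / real m \<le> 1" using assms by (simp add: field_simps)
next
  fix s :: nat and x :: real assume "s < m" "x \<in> {0..<1}"
  then show "digit m x = s \<longleftrightarrow> real s / real m \<le> x \<and> x < real s / real m + 1 / real m"
    using digit_eq_iff[of m s x] assms by (simp add: add_divide_distrib)
qed (use assms digit_less in auto)

section \<open>Piece lengths and the baker maps\<close>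

text \<open>These are the lengths on the \<open>x\<close>-axis. The \<open>z\<close>-axis uses
  \<open>len m (1 - p)\<close>, whose piece \<open>m\<close> has length \<open>p\<close> and whose
  other pieces have length \<open>(1 - p) / m\<close>.\<close>

definition len :: "nat \<Rightarrow> real \<Rightarrow> nat \<Rightarrow> real" where
  "len m p s = (if s = m then 1 - p else p / real m)"

lemma len_simps [simp]: "len m p m = 1 - p" "i < m \<Longrightarrow> len m p i = p / real m"
  by (simp_all add: len_def)

text \<open>
  Pieces are indexed from 0: piece \<open>i < m\<close> of the \<open>x\<close>-axis carries \<open>\<alpha>\<^sub>i\<^sub>+\<^sub>1\<close> and piece \<open>m\<close> carries
  every \<open>\<beta>\<close>; on the \<open>z\<close>-axis piece \<open>m\<close> is the image of every \<open>\<alpha>\<close> and piece \<open>i < m\<close> that of \<open>\<beta>\<^sub>i\<^sub>+\<^sub>1\<close>.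
  Positions of the pieces are left open, so that exchanging \<open>x\<close> and \<open>z\<close> stays within the family.
\<close>

type_synonym point = "(real \<times> real) \<times> real"

fun base_map :: "nat \<Rightarrow> real \<Rightarrow> (real \<Rightarrow> nat) \<Rightarrow> (nat \<Rightarrow> real) \<Rightarrow> real \<times> real \<Rightarrow> real \<times> real" where
  "base_map m p brx cx (x, y) =
     (if brx x < m then ((x - cx (brx x)) / len m p (brx x), (y + real (brx x)) / real m)
      else ((x - cx m) / len m p m, real m * y - real (digit m y)))"

fun cube_map :: "nat \<Rightarrow> real \<Rightarrow> (real \<Rightarrow> nat) \<Rightarrow> (nat \<Rightarrow> real) \<Rightarrow> (nat \<Rightarrow> real) \<Rightarrow> point \<Rightarrow> point" where
  "cube_map m p brx cx cz ((x, y), z) =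
     (base_map m p brx cx (x, y),
      if brx x < m then cz m + p * z else cz (digit m y) + (1 - p) / real m * z)"

fun swap_xz :: "point \<Rightarrow> point" where
  "swap_xz ((x, y), z) = ((z, y), x)"

locale baker =
  X: full_branches "Suc m" brx cx "len m p" + Z: full_branches "Suc m" brz cz "len m (1 - p)"
  for m :: nat and p :: real and brx cx brz cz +
  assumes m_ge: "m \<ge> 2" and p_bounds: "0 < p" "p < 1"
begin

lemma m_pos: "m > 0" "real m > 0" using m_ge by auto

sublocale Y: full_branches m "digit m" "\<lambda>i. real i / real m" "\<lambda>_. 1 / real m"
  using m_pos by (intro full_branches_digit) simp

abbreviation f where "f \<equiv> base_map m p brx cx"
abbreviation g where "g \<equiv> cube_map m p brx cx cz"

text \<open>The two partitions trade places and \<open>1 - (1 - p) = p\<close>, so every result of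
  the locale is also available for the reversed map.\<close>

lemma swap: "baker m (1 - p) brz cz brx cx"
  using m_ge p_bounds X.full_branches_axioms Z.full_branches_axioms
  by (simp add: baker_def baker_axioms_def)

lemma f_measurable [measurable]: "f \<in> unif2 \<rightarrow>\<^sub>M unif2"
proof -
  have [measurable]: "(\<lambda>x. h (brx x)) \<in> borel_measurable borel" for h :: "nat \<Rightarrow> real" by measurable
  have "f = (\<lambda>w. if brx (fst w) < m
      then ((fst w - cx (brx (fst w))) / len m p (brx (fst w)), (snd w + real (brx (fst w))) / real m)
      else ((fst w - cx m) / len m p m, real m * snd w - real (digit m (snd w))))"
    by (auto simp: fun_eq_iff)
  also have "\<dots> \<in> unif2 \<rightarrow>\<^sub>M unif2" by measurable
  finally show ?thesis .
qed

lemma g_measurable [measurable]: "g \<in> unif3 \<rightarrow>\<^sub>M unif3"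
proof -
  have "g = (\<lambda>w. (f (fst w), if brx (fst (fst w)) < m then cz m + p * snd w
      else cz (digit m (snd (fst w))) + (1 - p) / real m * snd w))"
    by (auto simp: fun_eq_iff)
  also have "\<dots> \<in> unif3 \<rightarrow>\<^sub>M unif3" by measurable
  finally show ?thesis .
qed

lemma fst_g: "fst (g w) = f (fst w)"
  by (cases w; cases "fst w") auto

lemma fst_g_pow: "fst ((g ^^ n) w) = (f ^^ n) (fst w)"
  by (induction n) (simp_all add: fst_g)

lemma g_pow_measurable [measurable]: "g ^^ n \<in> unif3 \<rightarrow>\<^sub>M unif3"
  by (rule measurable_compose_n) measurable

lemma f_pow_measurable [measurable]: "f ^^ n \<in> unif2 \<rightarrow>\<^sub>M unif2"
  by (rule measurable_compose_n) measurable

lemma brx_less: "x \<in> {0..<1} \<Longrightarrow> \<not> brx x < m \<Longrightarrow> brx x = m"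
  using X.br_less[of x] by simp

text \<open>Each coordinate is either stretched from a piece onto the whole interval or contracted
  into a piece; with half-open pieces the endpoint 1 stays excluded in both cases.\<close>

lemma g_mem: "w \<in> half_open_cube \<Longrightarrow> g w \<in> half_open_cube"
proof -
  assume "w \<in> half_open_cube"
  then obtain x y z where w: "w = ((x, y), z)" "x \<in> {0..<1}" "y \<in> {0..<1}" "z \<in> {0..<1}"
    by (auto simp: half_open_cube_def)
  show ?thesis
  proof (cases "brx x < m")
    case True
    then show ?thesis
      using w X.branch[OF w(2) refl] Y.inverse_branch(1)[OF True w(3)]
        Z.inverse_branch(1)[of m, OF _ w(4)]
      by (simp add: half_open_cube_def add_divide_distrib add.commute)
  next
    case False
    have d: "digit m y < m" using m_pos by (simp add: digit_less)
    show ?thesis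
      using False w X.branch[OF w(2) brx_less[OF w(2) False]] digit_shift[OF m_pos(1) w(3)]
        Z.inverse_branch(1)[of "digit m y", OF _ w(4)] d m_pos
      by (simp add: half_open_cube_def)
  qed
qed

text \<open>The new \<open>z\<close> records the branch taken: an \<alpha> step puts it in piece
  \<open>m\<close>, a \<beta> step in the piece indexed by the popped digit. The reversed map reads
  that piece, and accordingly pops the digit that was pushed or pushes back the one that was
  popped.\<close>

lemma inverse:
  assumes "w \<in> half_open_cube"
  shows "swap_xz (cube_map m (1 - p) brz cz cx (swap_xz (g w))) = w"
proof -
  obtain x y z where w: "w = ((x, y), z)" "x \<in> {0..<1}" "y \<in> {0..<1}" "z \<in> {0..<1}"
    using assms by (auto simp: half_open_cube_def)
  show ?thesis
  proof (cases "brx x < m")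
    case True
    have "brz (cz m + p * z) = m" "digit m ((y + real (brx x)) / real m) = brx x"
      using Z.inverse_branch(2)[of m z] w(4) Y.inverse_branch(2)[OF True w(3)]
      by (simp_all add: add_divide_distrib add.commute)
    then show ?thesis
      using w(1) True p_bounds m_pos by simp
  next
    case False
    have d: "digit m y < m" using m_pos by (simp add: digit_less)
    then have "brz (cz (digit m y) + (1 - p) / real m * z) = digit m y"
      using Z.inverse_branch(2)[of "digit m y" z] w(4) by simp
    then show ?thesis
      using w(1) False d p_bounds m_pos by simp
  qed
qed

end

section \<open>Invariance of the measure and the transfer operator\<close>

lemma integral_unif3_cong:
  assumes "f \<in> bmeas unif3" "h \<in> bmeas unif3" "\<And>w. w \<in> half_open_cube \<Longrightarrow> f w = h w"
  shows "(\<integral>w. f w \<partial>unif3) = (\<integral>w. h w \<partial>unif3)"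
proof (rule integral_cong_AE)
  show "AE w in unif3. f w = h w"
    by (rule eventually_mono[OF AE_unif3]) (rule assms(3))
qed (use assms in \<open>auto simp: bmeas_def\<close>)

lemma half_open_cube_E:
  assumes "w \<in> half_open_cube"
  obtains x y z where "w = ((x, y), z)" "x \<in> {0..<1}" "y \<in> {0..<1}" "z \<in> {0..<1}"
  using assms by (auto simp: half_open_cube_def)

lemma sum_len:
  assumes "\<And>i. i < m \<Longrightarrow> a i = b i"
  shows "(\<Sum>s<Suc m. len m q s * a s) = (\<Sum>i<m. q / real m * b i) + (1 - q) * a m"
  using assms by simp

context baker
begin

text \<open>Affine inverse branches acting on a single coordinate. On the half-open cube,
  \<open>g (at_x i w) = at_z m (at_y i w)\<close> for \<open>i < m\<close> and
  \<open>g (at_x m (at_y i w)) = at_z i w\<close>; invariance of the measure rests on these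
  identities, duality on their \<open>(x, y)\<close> parts.\<close>

abbreviation "at_x s w \<equiv> ((cx s + len m p s * fst (fst w), snd (fst w)), snd w)"
abbreviation "at_y i w \<equiv> ((fst (fst w), real i / real m + 1 / real m * snd (fst w)), snd w)"
abbreviation "at_z s w \<equiv> (fst w, cz s + len m (1 - p) s * snd w)"

lemma splits_x: "splits unif3 (Suc m) (len m p) (\<lambda>s w. at_x s w)"
  using splits_fst[OF splits_fst[OF X.splits_unif prob_space_unif prob_space_unif]
    unif2.P.prob_space_axioms prob_space_unif]
  by simp

lemma splits_y: "splits unif3 m (\<lambda>_. 1 / real m) (\<lambda>i w. at_y i w)"
  using splits_fst[OF splits_snd[OF Y.splits_unif prob_space_unif prob_space_unif]
    unif2.P.prob_space_axioms prob_space_unif]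
  by simp

lemma splits_z: "splits unif3 (Suc m) (len m (1 - p)) (\<lambda>s w. at_z s w)"
  using splits_snd[OF Z.splits_unif prob_space_unif unif2.P.prob_space_axioms]
  by simp

text \<open>Condition on the \<open>x\<close>-piece, and in the \<beta> case also on the first digit
  of \<open>y\<close>. The branch identities turn this into the decomposition by the
  \<open>z\<close>-piece, with piece \<open>m\<close> split further by the first digit.\<close>

lemma integral_g:
  assumes h: "h \<in> bmeas unif3"
  shows "(\<integral>w. h (g w) \<partial>unif3) = (\<integral>w. h w \<partial>unif3)"
proof -
  have bm: "(\<lambda>w. h (k w)) \<in> bmeas unif3" if "k \<in> unif3 \<rightarrow>\<^sub>M unif3" for k
    using h that by (rule bmeas_comp)
  have alpha: "(\<integral>w. h (g (at_x i w)) \<partial>unif3) = (\<integral>w. h (at_z m (at_y i w)) \<partial>unif3)"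
    if i: "i < m" for i
  proof (rule integral_unif3_cong)
    fix w assume "w \<in> half_open_cube"
    then show "h (g (at_x i w)) = h (at_z m (at_y i w))"
    proof (cases rule: half_open_cube_E)
      case (1 x y z)
      have "brx (cx i + p / real m * x) = i" using X.inverse_branch(2)[of i x] i 1 by simp
      then show ?thesis using 1 i p_bounds m_pos by (simp add: add_divide_distrib add.commute)
    qed
  qed (rule bm, measurable)+
  have beta: "(\<integral>w. h (g (at_x m w)) \<partial>unif3) = (\<Sum>i<m. 1 / real m * (\<integral>w. h (at_z i w) \<partial>unif3))"
  proof -
    have "(\<integral>w. h (g (at_x m w)) \<partial>unif3) =
        (\<Sum>i<m. 1 / real m * (\<integral>w. h (g (at_x m (at_y i w))) \<partial>unif3))"
      by (rule splitsD[OF splits_y], rule bm) measurable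
    also have "\<dots> = (\<Sum>i<m. 1 / real m * (\<integral>w. h (at_z i w) \<partial>unif3))"
    proof (rule sum.cong[OF refl], rule arg_cong2[where f="(*)", OF refl], rule integral_unif3_cong)
      fix i w assume i: "i \<in> {..<m}" and "w \<in> half_open_cube"
      then show "h (g (at_x m (at_y i w))) = h (at_z i w)"
      proof (elim half_open_cube_E)
        fix x y z assume w: "w = ((x, y), z)" "x \<in> {0..<1}" "y \<in> {0..<1}" "z \<in> {0..<1}"
        have "brx (cx m + (1 - p) * x) = m" "digit m (real i / real m + 1 / real m * y) = i"
          using X.inverse_branch(2)[of m x] Y.inverse_branch(2)[of i y] i w by simp_all
        then show ?thesis using w i p_bounds m_pos by (simp add: distrib_left)
      qed
    qed (rule bm, measurable)+
    finally show ?thesis .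
  qed
  have "(\<integral>w. h (g w) \<partial>unif3) = (\<Sum>s<Suc m. len m p s * (\<integral>w. h (g (at_x s w)) \<partial>unif3))"
    by (rule splitsD[OF splits_x], rule bm) measurable
  also have "\<dots> = (\<Sum>i<m. p / real m * (\<integral>w. h (at_z m (at_y i w)) \<partial>unif3)) +
      (1 - p) * (\<integral>w. h (g (at_x m w)) \<partial>unif3)"
    by (rule sum_len[OF alpha])
  also note beta
  \<comment> \<open>An \<alpha> term of weight \<open>p / m\<close> is read as
    \<open>z\<close>-piece \<open>m\<close>, of weight \<open>p\<close>, times a digit of weight
    \<open>1 / m\<close>; the \<beta> terms become the \<open>z\<close>-pieces of weight
    \<open>(1 - p) / m\<close>.\<close>
  also have "(\<Sum>i<m. p / real m * (\<integral>w. h (at_z m (at_y i w)) \<partial>unif3)) +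
      (1 - p) * (\<Sum>i<m. 1 / real m * (\<integral>w. h (at_z i w) \<partial>unif3)) =
      (\<Sum>i<m. (1 - p) / real m * (\<integral>w. h (at_z i w) \<partial>unif3)) +
      p * (\<Sum>i<m. 1 / real m * (\<integral>w. h (at_z m (at_y i w)) \<partial>unif3))"
    by (simp add: sum_distrib_left algebra_simps)
  also have "(\<Sum>i<m. 1 / real m * (\<integral>w. h (at_z m (at_y i w)) \<partial>unif3)) = (\<integral>w. h (at_z m w) \<partial>unif3)"
    by (rule splitsD[OF splits_y, symmetric], rule bm) measurable
  also have "(\<Sum>i<m. (1 - p) / real m * (\<integral>w. h (at_z i w) \<partial>unif3)) + p * (\<integral>w. h (at_z m w) \<partial>unif3) =
      (\<Sum>s<Suc m. len m (1 - p) s * (\<integral>w. h (at_z s w) \<partial>unif3))"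
    by (subst sum_len[OF refl]) simp
  also have "\<dots> = (\<integral>w. h w \<partial>unif3)"
    by (rule splitsD[OF splits_z h, symmetric])
  finally show ?thesis .
qed

lemma g_pow_mem: "w \<in> half_open_cube \<Longrightarrow> (g ^^ n) w \<in> half_open_cube"
  by (induction n) (simp_all add: g_mem)

lemma integral_g_pow:
  assumes "h \<in> bmeas unif3"
  shows "(\<integral>w. h ((g ^^ n) w) \<partial>unif3) = (\<integral>w. h w \<partial>unif3)"
proof (induction n)
  case (Suc n)
  have "(\<lambda>w. h ((g ^^ n) w)) \<in> bmeas unif3" by (rule bmeas_comp[OF assms]) measurable
  from integral_g[OF this] show ?case by (simp add: Suc funpow_swap1)
qed simp

lemma distr_g: "distr unif3 unif3 g = unif3"
proof (rule measure_eqI)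
  fix A assume "A \<in> sets (distr unif3 unif3 g)"
  then have A [measurable]: "A \<in> sets unif3" by simp
  have "(indicator A :: _ \<Rightarrow> real) \<in> bmeas unif3"
    by (rule bmeasI[where B=1]) (auto simp: indicator_def A)
  from integral_g[OF this]
  have "(\<integral>w. indicator (g -` A \<inter> space unif3) w \<partial>unif3) = (\<integral>w. indicator A w \<partial>unif3 :: real)"
    by (simp add: indicator_def space_pair_measure)
  moreover have "g -` A \<inter> space unif3 \<in> sets unif3" by (rule measurable_sets[OF g_measurable A])
  ultimately have "measure unif3 (g -` A \<inter> space unif3) = measure unif3 A"
    using A by (simp add: sets.Int_space_eq2)
  then show "emeasure (distr unif3 unif3 g) A = emeasure unif3 A"
    by (simp add: emeasure_distr[OF g_measurable A] unif3.P.emeasure_eq_measure)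
qed simp

section \<open>The transfer operator of \<open>f\<close> and its duality\<close>

text \<open>The Perron-Frobenius operator for Lebesgue measure. A point has one \<alpha> preimage,
  selected by the first digit of \<open>y\<close>, with inverse Jacobian \<open>p\<close>, and
  \<open>m\<close> \<beta> preimages, each with inverse Jacobian \<open>(1 - p) / m\<close>.\<close>

definition transfer :: "(real \<times> real \<Rightarrow> real) \<Rightarrow> real \<times> real \<Rightarrow> real" where
  "transfer u = (\<lambda>(x, y).
     p * u (cx (digit m y) + p / real m * x, real m * y - real (digit m y)) +
     (1 - p) / real m * (\<Sum>j<m. u (cx m + (1 - p) * x, real j / real m + 1 / real m * y)))"

lemma transfer_bmeas:
  assumes "u \<in> bmeas unif2"
  shows "transfer u \<in> bmeas unif2"
proof -
  have bm: "(\<lambda>w. u (k w)) \<in> bmeas unif2" if "k \<in> unif2 \<rightarrow>\<^sub>M unif2" for k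
    using assms that by (rule bmeas_comp)
  show ?thesis
    unfolding transfer_def split_beta
    by (intro bmeas_add bmeas_mult bmeas_const bmeas_sum) (rule bm, measurable)+
qed

text \<open>Change of variables along the inverse branches of \<open>f\<close>. The integrals run
  over the cube although the integrands depend on \<open>(x, y)\<close> only, so that the splittings
  of \<open>unif3\<close> apply as they stand.\<close>

lemma transfer_dual:
  assumes u: "u \<in> bmeas unif2" and v: "v \<in> bmeas unif2"
  shows "(\<integral>w. u (fst w) * v (f (fst w)) \<partial>unif3) = (\<integral>w. transfer u (fst w) * v (fst w) \<partial>unif3)"
proof -
  have bu: "(\<lambda>w. u (k w)) \<in> bmeas unif3" if "k \<in> unif3 \<rightarrow>\<^sub>M unif2" for k
    using u that by (rule bmeas_comp)
  have bv: "(\<lambda>w. v (k w)) \<in> bmeas unif3" if "k \<in> unif3 \<rightarrow>\<^sub>M unif2" for k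
    using v that by (rule bmeas_comp)
  note bm = bmeas_mult[OF bu bv]
  let ?A = "\<lambda>i. \<integral>w. u (fst (at_x i w)) * v (fst (at_y i w)) \<partial>unif3"
  let ?B = "\<lambda>j. \<integral>w. u (fst (at_x m (at_y j w))) * v (fst w) \<partial>unif3"
  have alpha: "(\<integral>w. u (fst (at_x i w)) * v (f (fst (at_x i w))) \<partial>unif3) = ?A i" if i: "i < m" for i
  proof (rule integral_unif3_cong)
    fix w assume "w \<in> half_open_cube"
    then show "u (fst (at_x i w)) * v (f (fst (at_x i w))) = u (fst (at_x i w)) * v (fst (at_y i w))"
    proof (cases rule: half_open_cube_E)
      case (1 x y z)
      have "brx (cx i + p / real m * x) = i" using X.inverse_branch(2)[of i x] i 1 by simp
      then show ?thesis using 1 i p_bounds m_pos by (simp add: add_divide_distrib add.commute)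
    qed
  qed (rule bm; measurable)+
  have beta: "(\<integral>w. u (fst (at_x m w)) * v (f (fst (at_x m w))) \<partial>unif3) = (\<Sum>j<m. 1 / real m * ?B j)"
  proof -
    have "(\<integral>w. u (fst (at_x m w)) * v (f (fst (at_x m w))) \<partial>unif3) =
        (\<Sum>j<m. 1 / real m * (\<integral>w. u (fst (at_x m (at_y j w))) * v (f (fst (at_x m (at_y j w)))) \<partial>unif3))"
      by (rule splitsD[OF splits_y], rule bm) measurable
    also have "\<dots> = (\<Sum>j<m. 1 / real m * ?B j)"
    proof (rule sum.cong[OF refl], rule arg_cong2[where f="(*)", OF refl], rule integral_unif3_cong)
      fix j w assume j: "j \<in> {..<m}" and "w \<in> half_open_cube"
      then show "u (fst (at_x m (at_y j w))) * v (f (fst (at_x m (at_y j w)))) =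
          u (fst (at_x m (at_y j w))) * v (fst w)"
      proof (elim half_open_cube_E)
        fix x y z assume w: "w = ((x, y), z)" "x \<in> {0..<1}" "y \<in> {0..<1}" "z \<in> {0..<1}"
        have "brx (cx m + (1 - p) * x) = m" "digit m (real j / real m + 1 / real m * y) = j"
          using X.inverse_branch(2)[of m x] Y.inverse_branch(2)[of j y] j w by simp_all
        then show ?thesis using w j p_bounds m_pos by (simp add: distrib_left)
      qed
    qed (rule bm; measurable)+
    finally show ?thesis .
  qed
  \<comment> \<open>The \<alpha> half of \<open>transfer u\<close> times \<open>v\<close>; splitting
    \<open>y\<close> by its first digit turns its integral into the sum over the \<alpha>
    branches.\<close>
  let ?P = "\<lambda>w. p * u (cx (digit m (snd (fst w))) + p / real m * fst (fst w),
      real m * snd (fst w) - real (digit m (snd (fst w)))) * v (fst w)"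
  have P: "(\<integral>w. ?P w \<partial>unif3) = (\<Sum>i<m. p / real m * ?A i)"
  proof -
    have "(\<integral>w. ?P w \<partial>unif3) = (\<Sum>i<m. 1 / real m * (\<integral>w. ?P (at_y i w) \<partial>unif3))"
      by (rule splitsD[OF splits_y], intro bmeas_mult bu bv bmeas_const) measurable
    also have "\<dots> = (\<Sum>i<m. 1 / real m * (\<integral>w. p * (u (fst (at_x i w)) * v (fst (at_y i w))) \<partial>unif3))"
    proof (rule sum.cong[OF refl], rule arg_cong2[where f="(*)", OF refl], rule integral_unif3_cong)
      fix i w assume i: "i \<in> {..<m}" and "w \<in> half_open_cube"
      then show "?P (at_y i w) = p * (u (fst (at_x i w)) * v (fst (at_y i w)))"
      proof (elim half_open_cube_E)
        fix x y z assume w: "w = ((x, y), z)" "x \<in> {0..<1}" "y \<in> {0..<1}" "z \<in> {0..<1}"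
        have "digit m (real i / real m + 1 / real m * y) = i"
          using Y.inverse_branch(2)[of i y] i w by simp_all
        then show ?thesis using w i p_bounds m_pos by (simp add: distrib_left)
      qed
    qed (intro bmeas_mult bu bv bmeas_const; measurable)+
    finally show ?thesis by simp
  qed
  have int: "integrable unif3 (\<lambda>w. (1 - p) / real m * (u (fst (at_x m (at_y j w))) * v (fst w)))" for j
    by (intro unif3.P.bmeas_integrable bmeas_mult bmeas_const bu bv) measurable
  have "(\<integral>w. u (fst w) * v (f (fst w)) \<partial>unif3) =
      (\<Sum>s<Suc m. len m p s * (\<integral>w. u (fst (at_x s w)) * v (f (fst (at_x s w))) \<partial>unif3))"
    by (rule splitsD[OF splits_x], rule bm) measurable
  also have "\<dots> = (\<Sum>i<m. p / real m * ?A i) +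
      (1 - p) * (\<integral>w. u (fst (at_x m w)) * v (f (fst (at_x m w))) \<partial>unif3)"
    by (rule sum_len[OF alpha])
  also note beta
  also have "(1 - p) * (\<Sum>j<m. 1 / real m * ?B j) = (\<Sum>j<m. (1 - p) / real m * ?B j)"
    by (simp add: sum_distrib_left)
  also have "(\<Sum>j<m. (1 - p) / real m * ?B j) =
      (\<integral>w. (\<Sum>j<m. (1 - p) / real m * (u (fst (at_x m (at_y j w))) * v (fst w))) \<partial>unif3)"
    by (simp only: Bochner_Integration.integral_sum[OF int] integral_mult_right_zero)
  also have "(\<Sum>i<m. p / real m * ?A i) + \<dots> =
      (\<integral>w. ?P w + (\<Sum>j<m. (1 - p) / real m * (u (fst (at_x m (at_y j w))) * v (fst w))) \<partial>unif3)"
    unfolding P[symmetric]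
    by (rule Bochner_Integration.integral_add[symmetric]; rule unif3.P.bmeas_integrable;
        intro bmeas_mult bmeas_sum bu bv bmeas_const; measurable)
  also have "\<dots> = (\<integral>w. transfer u (fst w) * v (fst w) \<partial>unif3)"
    by (rule Bochner_Integration.integral_cong)
       (auto simp: transfer_def split_beta algebra_simps sum_distrib_left sum_distrib_right sum_divide_distrib)
  finally show ?thesis .
qed

end

section \<open>Contraction of the transfer operator\<close>

text \<open>Membership in a common cylinder of level \<open>N\<close>, phrased through the digit
  shift so that pushing or popping a common digit changes \<open>N\<close> by exactly one.\<close>

fun same_digits :: "nat \<Rightarrow> nat \<Rightarrow> real \<Rightarrow> real \<Rightarrow> bool" where
  "same_digits m 0 y y' = True"
| "same_digits m (Suc N) y y' = (digit m y = digit m y' \<and>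
     same_digits m N (real m * y - real (digit m y)) (real m * y' - real (digit m y')))"

text \<open>On a common cylinder of level 1 the shift expands distances exactly by the factor
  \<open>m\<close>.\<close>

lemma same_digits_dist:
  assumes "m > 0" "y \<in> {0..<1}" "y' \<in> {0..<1}" "same_digits m N y y'"
  shows "\<bar>y - y'\<bar> \<le> (1 / real m) ^ N"
  using assms(2-)
proof (induction N arbitrary: y y')
  case (Suc N)
  let ?T = "\<lambda>y. real m * y - real (digit m y)"
  have "same_digits m N (?T y) (?T y')" using Suc.prems(3) unfolding same_digits.simps by blast
  then have "\<bar>?T y - ?T y'\<bar> \<le> (1 / real m) ^ N"
    using Suc.prems(1,2) by (intro Suc.IH digit_shift assms(1))
  moreover have "?T y - ?T y' = real m * (y - y')"
    using Suc.prems by (simp add: algebra_simps)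
  ultimately have "real m * \<bar>y - y'\<bar> \<le> (1 / real m) ^ N" by (simp add: abs_mult)
  then show ?case using assms(1) by (simp add: field_simps)
qed auto

context baker
begin

text \<open>\<open>A\<close> controls the oscillation in \<open>y\<close> over cylinders of all
  levels at once, in units of \<open>\<theta> ^ N\<close>; \<open>W\<close> is a Hoelder constant in
  \<open>x\<close>.\<close>

definition regular :: "real \<Rightarrow> real \<Rightarrow> real \<Rightarrow> real \<Rightarrow> (real \<times> real \<Rightarrow> real) \<Rightarrow> bool" where
  "regular \<eta> \<theta> A W u \<longleftrightarrow>
     (\<forall>x\<in>{0..<1}. \<forall>y\<in>{0..<1}. \<forall>y'\<in>{0..<1}. \<forall>N.
        same_digits m N y y' \<longrightarrow> \<bar>u (x, y) - u (x, y')\<bar> \<le> A * \<theta> ^ N) \<and>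
     (\<forall>x\<in>{0..<1}. \<forall>x'\<in>{0..<1}. \<forall>y\<in>{0..<1}. \<bar>u (x, y) - u (x', y)\<bar> \<le> W * \<bar>x - x'\<bar> powr \<eta>)"

text \<open>Level 0 imposes no condition on the digits, so \<open>A\<close> bounds the oscillation
  along a vertical segment; \<open>W\<close> bounds it along a horizontal one, whose length is at
  most 1.\<close>

lemma regular_osc:
  assumes "regular \<eta> \<theta> A W u" "0 \<le> W" "0 < \<eta>"
    "x \<in> {0..<1}" "y \<in> {0..<1}" "x' \<in> {0..<1}" "y' \<in> {0..<1}"
  shows "\<bar>u (x, y) - u (x', y')\<bar> \<le> A + W"
proof -
  have "\<bar>u (x, y) - u (x, y')\<bar> \<le> A * \<theta> ^ 0"
    using assms unfolding regular_def by (metis same_digits.simps(1))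
  moreover have "\<bar>u (x, y') - u (x', y')\<bar> \<le> W * \<bar>x - x'\<bar> powr \<eta>"
    using assms unfolding regular_def by blast
  moreover have "\<bar>x - x'\<bar> powr \<eta> \<le> 1"
    using assms by (intro powr_le1) auto
  then have "W * \<bar>x - x'\<bar> powr \<eta> \<le> W" using assms(2) by (simp add: mult_left_le)
  ultimately show ?thesis by simp
qed

text \<open>A common bound for the slopes \<open>p / m\<close> and \<open>1 - p\<close> of the
  inverse branches in \<open>x\<close> and the slopes \<open>p\<close> and
  \<open>(1 - p) / m\<close> of \<open>g\<close> in \<open>z\<close>.\<close>

definition kappa :: real where "kappa = max p (1 - p)"

lemma kappa_bounds: "0 < kappa" "kappa < 1" "p \<le> kappa" "1 - p \<le> kappa"
  using p_bounds by (auto simp: kappa_def)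

lemma div_m_le: "0 \<le> t \<Longrightarrow> t / real m \<le> t"
  using m_ge by (simp add: divide_le_eq mult_le_cancel_left1)

text \<open>The operator averages, with weight \<open>p\<close> on the \<alpha> preimage and total
  weight \<open>1 - p\<close> on the \<beta> preimages, so bounds on differences are averaged in the
  same way.\<close>

lemma transfer_osc:
  fixes B E :: real
  assumes "\<bar>u (cx (digit m y) + p / real m * x, real m * y - real (digit m y)) -
      u (cx (digit m y') + p / real m * x', real m * y' - real (digit m y'))\<bar> \<le> B"
    and "\<And>j. j < m \<Longrightarrow> \<bar>u (cx m + (1 - p) * x, real j / real m + 1 / real m * y) -
      u (cx m + (1 - p) * x', real j / real m + 1 / real m * y')\<bar> \<le> E"
  shows "\<bar>transfer u (x, y) - transfer u (x', y')\<bar> \<le> p * B + (1 - p) * E"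
proof -
  define a where "a = u (cx (digit m y) + p / real m * x, real m * y - real (digit m y)) -
      u (cx (digit m y') + p / real m * x', real m * y' - real (digit m y'))"
  define b where "b = (\<lambda>j. u (cx m + (1 - p) * x, real j / real m + 1 / real m * y) -
      u (cx m + (1 - p) * x', real j / real m + 1 / real m * y'))"
  have "transfer u (x, y) - transfer u (x', y') = p * a + (1 - p) / real m * (\<Sum>j<m. b j)"
    unfolding transfer_def prod.case a_def b_def sum_subtractf right_diff_distrib by linarith
  also have "\<bar>\<dots>\<bar> \<le> \<bar>p * a\<bar> + \<bar>(1 - p) / real m * (\<Sum>j<m. b j)\<bar>"
    by (rule abs_triangle_ineq)
  also have "\<bar>p * a\<bar> \<le> p * B"
    using assms(1) p_bounds by (simp add: abs_mult a_def)
  also have "\<bar>(1 - p) / real m * (\<Sum>j<m. b j)\<bar> \<le> (1 - p) / real m * (real m * E)"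
  proof -
    have "\<bar>\<Sum>j<m. b j\<bar> \<le> (\<Sum>j<m. \<bar>b j\<bar>)" by (rule sum_abs)
    also have "\<dots> \<le> (\<Sum>j<m. E)" by (rule sum_mono) (use assms(2) in \<open>simp add: b_def\<close>)
    finally have "\<bar>\<Sum>j<m. b j\<bar> \<le> real m * E" by simp
    then show ?thesis
      using p_bounds m_pos unfolding abs_mult by (intro mult_mono) auto
  qed
  finally show ?thesis using m_pos by simp
qed

text \<open>A \<beta> preimage prepends a common digit, raising the level by one and gaining a
  factor \<open>\<theta>\<close>. The \<alpha> preimage removes the first digit, which costs
  \<open>1 / \<theta>\<close> when \<open>N > 0\<close>. In \<open>x\<close> every inverse branch
  contracts by at least \<open>kappa\<close>, so Hoelder constants shrink by
  \<open>kappa powr \<eta>\<close>.\<close>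

lemma regular_transfer:
  assumes u: "regular \<eta> \<theta> A W u"
    and \<theta>: "0 < \<theta>" and \<eta>: "0 < \<eta>" and AW: "0 \<le> A" "0 \<le> W"
    and \<rho>: "kappa powr \<eta> \<le> \<rho>" "p / \<theta> + (1 - p) * \<theta> \<le> \<rho>"
    and A: "(p + (1 - p) * \<theta>) * A + p * W \<le> \<rho> * A"
  shows "regular \<eta> \<theta> (\<rho> * A) (\<rho> * W) (transfer u)"
proof -
  have uy: "\<bar>u (x, y) - u (x, y')\<bar> \<le> A * \<theta> ^ N"
    if "x \<in> {0..<1}" "y \<in> {0..<1}" "y' \<in> {0..<1}" "same_digits m N y y'" for x y y' N
    using u that unfolding regular_def by blast
  have ux: "\<bar>u (x, y) - u (x', y)\<bar> \<le> W * \<bar>x - x'\<bar> powr \<eta>"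
    if "x \<in> {0..<1}" "x' \<in> {0..<1}" "y \<in> {0..<1}" for x x' y
    using u that unfolding regular_def by blast
  have hm: "cx m + (1 - p) * x \<in> {0..<1}" if "x \<in> {0..<1}" for x
    using X.inverse_branch(1)[of m x] that by simp
  have hd: "cx (digit m y) + p / real m * x \<in> {0..<1}" if "x \<in> {0..<1}" for x y
    using X.inverse_branch(1)[of "digit m y" x] that digit_less[OF m_pos(1), of y] by simp
  have yj: "real j / real m + 1 / real m * y \<in> {0..<1}"
    "same_digits m (Suc N) (real j / real m + 1 / real m * y) (real j / real m + 1 / real m * y')
      \<longleftrightarrow> same_digits m N y y'"
    if "j < m" "y \<in> {0..<1}" "y' \<in> {0..<1}" for j y y' N
  proof -
    show "real j / real m + 1 / real m * y \<in> {0..<1}" using that by (intro Y.inverse_branch)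
    have "digit m (real j / real m + 1 / real m * t) = j" if "t \<in> {0..<1}" for t
      using Y.inverse_branch(2)[OF \<open>j < m\<close> that] .
    then show "same_digits m (Suc N) (real j / real m + 1 / real m * y)
        (real j / real m + 1 / real m * y') \<longleftrightarrow> same_digits m N y y'"
      using that m_pos by (simp add: distrib_left)
  qed
  have "\<bar>transfer u (x, y) - transfer u (x, y')\<bar> \<le> \<rho> * A * \<theta> ^ N"
    if x: "x \<in> {0..<1}" and y: "y \<in> {0..<1}" "y' \<in> {0..<1}" and N: "same_digits m N y y'" for x y y' N
  proof -
    have E: "\<bar>u (cx m + (1 - p) * x, real j / real m + 1 / real m * y) -
      u (cx m + (1 - p) * x, real j / real m + 1 / real m * y')\<bar> \<le> A * \<theta> ^ Suc N" if "j < m" for j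
      using that x y N yj by (intro uy hm) auto
    show ?thesis
    proof (cases N)
      \<comment> \<open>The first digits of \<open>y\<close> and \<open>y'\<close> may differ, so
        the \<alpha> preimages may lie in different \<open>x\<close>-pieces. Only the total
        oscillation \<open>A + W\<close> is available; the last hypothesis absorbs it.\<close>
      case 0
      have "\<bar>u (cx (digit m y) + p / real m * x, real m * y - real (digit m y)) -
        u (cx (digit m y') + p / real m * x, real m * y' - real (digit m y'))\<bar> \<le> A + W"
        using x y by (intro regular_osc[OF u AW(2) \<eta>] hd digit_shift m_pos)
      from transfer_osc[OF this E] have
        "\<bar>transfer u (x, y) - transfer u (x, y')\<bar> \<le> p * (A + W) + (1 - p) * (A * \<theta> ^ Suc N)"
        by simp
      also have "\<dots> \<le> \<rho> * A * \<theta> ^ N" using A 0 by (simp add: algebra_simps)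
      finally show ?thesis .
    next
      case (Suc N')
      have "\<bar>u (cx (digit m y) + p / real m * x, real m * y - real (digit m y)) -
        u (cx (digit m y') + p / real m * x, real m * y' - real (digit m y'))\<bar> \<le> A * \<theta> ^ N'"
      proof -
        \<comment> \<open>Equal first digits give both \<alpha> preimages the same
          \<open>x\<close>-coordinate, so only the \<open>y\<close>-oscillation enters.\<close>
        have d: "digit m y = digit m y'"
          and same: "same_digits m N' (real m * y - real (digit m y)) (real m * y' - real (digit m y'))"
          using N unfolding Suc same_digits.simps by blast+
        have "\<bar>u (cx (digit m y) + p / real m * x, real m * y - real (digit m y)) -
          u (cx (digit m y) + p / real m * x, real m * y' - real (digit m y'))\<bar> \<le> A * \<theta> ^ N'"
          using x y same by (intro uy hd digit_shift m_pos)
        then show ?thesis by (simp only: d)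
      qed
      from transfer_osc[OF this E] have
        "\<bar>transfer u (x, y) - transfer u (x, y')\<bar> \<le> p * (A * \<theta> ^ N') + (1 - p) * (A * \<theta> ^ Suc N)"
        by simp
      also have "\<dots> = (p / \<theta> + (1 - p) * \<theta>) * (A * \<theta> ^ N)"
        using Suc \<theta> by (simp add: field_simps)
      also have "\<dots> \<le> \<rho> * (A * \<theta> ^ N)" using \<rho>(2) AW \<theta> by (intro mult_right_mono) auto
      finally show ?thesis by (simp add: mult.assoc)
    qed
  qed
  moreover have "\<bar>transfer u (x, y) - transfer u (x', y)\<bar> \<le> \<rho> * W * \<bar>x - x'\<bar> powr \<eta>"
    if x: "x \<in> {0..<1}" "x' \<in> {0..<1}" and y: "y \<in> {0..<1}" for x x' y
  proof -
    let ?D = "W * (\<rho> * \<bar>x - x'\<bar> powr \<eta>)"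
    have contr: "W * \<bar>(c + k * x) - (c + k * x')\<bar> powr \<eta> \<le> ?D" if "0 \<le> k" "k \<le> kappa" for c k
    proof -
      have "\<bar>(c + k * x) - (c + k * x')\<bar> = k * \<bar>x - x'\<bar>"
        using that by (simp add: abs_mult flip: right_diff_distrib)
      then have "\<bar>(c + k * x) - (c + k * x')\<bar> powr \<eta> = k powr \<eta> * \<bar>x - x'\<bar> powr \<eta>"
        using that by (simp add: powr_mult)
      also have "\<dots> \<le> \<rho> * \<bar>x - x'\<bar> powr \<eta>"
      proof (rule mult_right_mono)
        have "k powr \<eta> \<le> kappa powr \<eta>" using that \<eta> by (intro powr_mono2) simp_all
        then show "k powr \<eta> \<le> \<rho>" using \<rho>(1) by simp
      qed simp
      finally show ?thesis using AW(2) by (rule mult_left_mono)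
    qed
    have pk: "p / real m \<le> kappa" using div_m_le[of p] kappa_bounds p_bounds by linarith
    have "\<bar>transfer u (x, y) - transfer u (x', y)\<bar> \<le> p * ?D + (1 - p) * ?D"
    proof (rule transfer_osc)
      show "\<bar>u (cx (digit m y) + p / real m * x, real m * y - real (digit m y)) -
          u (cx (digit m y) + p / real m * x', real m * y - real (digit m y))\<bar> \<le> ?D"
        using x y pk p_bounds by (intro order_trans[OF ux contr] hd digit_shift m_pos) auto
      show "\<bar>u (cx m + (1 - p) * x, real j / real m + 1 / real m * y) -
          u (cx m + (1 - p) * x', real j / real m + 1 / real m * y)\<bar> \<le> ?D" if "j < m" for j
        using x y that kappa_bounds p_bounds by (intro order_trans[OF ux contr] hm yj(1)[OF that]) auto
    qed
    then show ?thesis by (simp add: algebra_simps)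
  qed
  ultimately show ?thesis unfolding regular_def by blast
qed

lemma transfer_pow_bmeas: "u \<in> bmeas unif2 \<Longrightarrow> (transfer ^^ n) u \<in> bmeas unif2"
  by (induction n) (simp_all add: transfer_bmeas)

text \<open>One use of \<open>transfer_dual\<close> per iterate; \<open>v\<close> is generalised
  because each step replaces it by \<open>v \<circ> f\<close>.\<close>

lemma transfer_pow_dual:
  assumes u: "u \<in> bmeas unif2" and v: "v \<in> bmeas unif2"
  shows "(\<integral>w. u (fst w) * v ((f ^^ n) (fst w)) \<partial>unif3) = (\<integral>w. (transfer ^^ n) u (fst w) * v (fst w) \<partial>unif3)"
  using v
proof (induction n arbitrary: v)
  case (Suc n)
  have vf: "(\<lambda>w. v (f w)) \<in> bmeas unif2" using Suc.prems by (rule bmeas_comp) measurable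
  have "(\<integral>w. u (fst w) * v ((f ^^ Suc n) (fst w)) \<partial>unif3) = (\<integral>w. (transfer ^^ n) u (fst w) * v (f (fst w)) \<partial>unif3)"
    using Suc.IH[OF vf] by simp
  also have "\<dots> = (\<integral>w. (transfer ^^ Suc n) u (fst w) * v (fst w) \<partial>unif3)"
    using transfer_dual[OF transfer_pow_bmeas[OF u] Suc.prems] by simp
  finally show ?case .
qed simp

lemma bmeas_fst: "u \<in> bmeas unif2 \<Longrightarrow> (\<lambda>w. u (fst w)) \<in> bmeas unif3"
  by (erule bmeas_comp) measurable

end

section \<open>Decay of correlations\<close>

text \<open>Hoelder continuity is asked for in each coordinate separately, a form stable under
  exchanging \<open>x\<close> and \<open>z\<close>, and only on the half-open cube, where
  \<open>g\<close> is invertible.\<close>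

definition coord_holder :: "real \<Rightarrow> real \<Rightarrow> (point \<Rightarrow> real) \<Rightarrow> bool" where
  "coord_holder \<eta> K h \<longleftrightarrow> (\<forall>s\<in>{0..<1}. \<forall>t\<in>{0..<1}. \<forall>x\<in>{0..<1}. \<forall>y\<in>{0..<1}.
     \<bar>h ((s, x), y) - h ((t, x), y)\<bar> \<le> K * \<bar>s - t\<bar> powr \<eta> \<and>
     \<bar>h ((x, s), y) - h ((x, t), y)\<bar> \<le> K * \<bar>s - t\<bar> powr \<eta> \<and>
     \<bar>h ((x, y), s) - h ((x, y), t)\<bar> \<le> K * \<bar>s - t\<bar> powr \<eta>)"

text \<open>As in the definition of exponential mixing, the rate is fixed before the observables.
  One \<open>K\<close> serves both of them, which keeps the notion symmetric in \<phi> and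
  \<psi>.\<close>

definition exp_decay :: "(point \<Rightarrow> point) \<Rightarrow> bool" where
  "exp_decay T \<longleftrightarrow> (\<forall>\<eta>>0. \<exists>r\<in>{0<..<1}. \<forall>\<phi>\<in>bmeas unif3. \<forall>\<psi>\<in>bmeas unif3. \<forall>K\<ge>0.
     coord_holder \<eta> K \<phi> \<longrightarrow> coord_holder \<eta> K \<psi> \<longrightarrow> (\<exists>C>0. \<forall>n. Cor n T \<phi> \<psi> unif3 \<le> C * r ^ n))"

lemma integral_fst_unif3:
  assumes "h \<in> bmeas unif2"
  shows "(\<integral>w. h (fst w) \<partial>unif3) = (\<integral>q. h q \<partial>unif2)"
  using integral_distr[of fst unif3 unif2 h] assms by (simp add: unif.distr_pair_fst bmeas_measurable)

section \<open>Exchanging the \<open>x\<close>- and \<open>z\<close>-coordinates\<close>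

lemma swap_xz_swap_xz [simp]: "swap_xz (swap_xz w) = w"
  by (cases w; cases "fst w") auto

lemma swap_xz_eq: "swap_xz = (\<lambda>w. ((snd w, snd (fst w)), fst (fst w)))"
  by (auto simp: fun_eq_iff)

lemma swap_xz_measurable [measurable]: "swap_xz \<in> unif3 \<rightarrow>\<^sub>M unif3"
  unfolding swap_xz_eq by measurable

text \<open>Written as threefold iterated integrals, the two sides differ only in the order of
  integration, which Fubini permits to change.\<close>

lemma integral_swap_xz:
  assumes h: "h \<in> bmeas unif3"
  shows "(\<integral>w. h (swap_xz w) \<partial>unif3) = (\<integral>w. h w \<partial>unif3)"
proof -
  have hf: "(\<lambda>w. h (swap_xz w)) \<in> bmeas unif3" using h by (rule bmeas_comp) measurable
  have "(\<integral>w. h (swap_xz w) \<partial>unif3) = (\<integral>q. (\<integral>z. h (swap_xz (q, z)) \<partial>unif) \<partial>unif2)"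
    by (rule unif3.integral_fst'[OF unif3.P.bmeas_integrable[OF hf], symmetric])
  also have "\<dots> = (\<integral>x. (\<integral>y. (\<integral>z. h ((z, y), x) \<partial>unif) \<partial>unif) \<partial>unif)"
    by (subst unif2.integral_fst'[OF unif2.P.bmeas_integrable[OF unif.bmeas_partial[OF hf]], symmetric]) simp
  also have "\<dots> = (\<integral>x. (\<integral>q. h (q, x) \<partial>unif2) \<partial>unif)"
  proof (rule Bochner_Integration.integral_cong[OF refl])
    fix x :: real
    have "(\<lambda>q. h (q, x)) \<in> bmeas unif2" using h by (rule bmeas_comp) measurable
    then have "integrable unif2 (\<lambda>(z, y). h ((z, y), x))"
      using unif2.P.bmeas_integrable by (simp add: case_prod_unfold)
    from unif2.integral_snd[OF this]
    show "(\<integral>y. (\<integral>z. h ((z, y), x) \<partial>unif) \<partial>unif) = (\<integral>q. h (q, x) \<partial>unif2)"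
      by (simp add: case_prod_unfold)
  qed
  also have "\<dots> = (\<integral>w. h w \<partial>unif3)"
    using unif3.integral_snd[of "\<lambda>q x. h (q, x)"] unif3.P.bmeas_integrable[OF h] by (simp add: case_prod_unfold)
  finally show ?thesis .
qed

lemma coord_holder_swap_xz: "coord_holder \<eta> K h \<Longrightarrow> coord_holder \<eta> K (\<lambda>w. h (swap_xz w))"
  unfolding coord_holder_def swap_xz.simps by blast

context baker
begin

lemma inverse_pow:
  assumes "w \<in> half_open_cube"
  shows "swap_xz ((cube_map m (1 - p) brz cz cx ^^ n) (swap_xz ((g ^^ n) w))) = w"
proof (induction n)
  case (Suc n)
  let ?gs = "cube_map m (1 - p) brz cz cx"
  have "?gs (swap_xz (g ((g ^^ n) w))) = swap_xz ((g ^^ n) w)"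
    using inverse[OF g_pow_mem[OF assms, of n]] by (metis swap_xz_swap_xz)
  then have "(?gs ^^ Suc n) (swap_xz ((g ^^ Suc n) w)) = (?gs ^^ n) (swap_xz ((g ^^ n) w))"
    by (simp add: funpow_swap1)
  then show ?case using Suc by simp
qed simp

text \<open>By invariance, \<phi> times \<open>\<psi> \<circ> g ^^ n\<close> has the same integral
  as \<psi> times the composition of \<phi> with the \<open>n\<close>-th iterate of the inverse of
  \<open>g\<close>. Conjugation by \<open>swap_xz\<close> turns these inverse iterates into forward
  iterates of the reversed map.\<close>

lemma Cor_swap:
  assumes \<phi>: "\<phi> \<in> bmeas unif3" and \<psi>: "\<psi> \<in> bmeas unif3"
  shows "Cor n g \<phi> \<psi> unif3 = Cor n (cube_map m (1 - p) brz cz cx) (\<lambda>w. \<psi> (swap_xz w)) (\<lambda>w. \<phi> (swap_xz w)) unif3"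
proof -
  interpret S: baker m "1 - p" brz cz brx cx by (rule swap)
  let ?gs = "cube_map m (1 - p) brz cz cx"
  have c\<phi>: "(\<lambda>w. \<phi> (k w)) \<in> bmeas unif3" if "k \<in> unif3 \<rightarrow>\<^sub>M unif3" for k
    using \<phi> that by (rule bmeas_comp)
  have c\<psi>: "(\<lambda>w. \<psi> (k w)) \<in> bmeas unif3" if "k \<in> unif3 \<rightarrow>\<^sub>M unif3" for k
    using \<psi> that by (rule bmeas_comp)
  let ?h = "\<lambda>w. \<phi> (swap_xz ((?gs ^^ n) (swap_xz w))) * \<psi> w"
  have h: "?h \<in> bmeas unif3" by (intro bmeas_mult \<psi> c\<phi>) measurable
  have "(\<integral>w. \<phi> w * \<psi> ((g ^^ n) w) \<partial>unif3) = (\<integral>w. ?h ((g ^^ n) w) \<partial>unif3)"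
    by (rule integral_unif3_cong; (intro bmeas_mult \<phi> c\<phi> c\<psi>)?; (measurable; fail)?) (simp add: inverse_pow)
  also have "\<dots> = (\<integral>w. ?h w \<partial>unif3)" by (rule integral_g_pow[OF h])
  also have "\<dots> = (\<integral>w. ?h (swap_xz w) \<partial>unif3)" by (rule integral_swap_xz[OF h, symmetric])
  finally show ?thesis
    by (simp add: Cor_def integral_swap_xz \<phi> \<psi> mult.commute)
qed

lemma exp_decay_swap:
  assumes "exp_decay (cube_map m (1 - p) brz cz cx)"
  shows "exp_decay g"
  unfolding exp_decay_def
proof (intro allI impI)
  fix \<eta> :: real assume "\<eta> > 0"
  with assms obtain r where r: "r \<in> {0<..<1}" and
    dec: "\<And>\<phi> \<psi> K. \<phi> \<in> bmeas unif3 \<Longrightarrow> \<psi> \<in> bmeas unif3 \<Longrightarrow> K \<ge> 0 \<Longrightarrow> coord_holder \<eta> K \<phi> \<Longrightarrow> coord_holder \<eta> K \<psi> \<Longrightarrow>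
      \<exists>C>0. \<forall>n. Cor n (cube_map m (1 - p) brz cz cx) \<phi> \<psi> unif3 \<le> C * r ^ n"
    unfolding exp_decay_def by meson
  have bf: "(\<lambda>w. h (swap_xz w)) \<in> bmeas unif3" if "h \<in> bmeas unif3" for h
    using that by (rule bmeas_comp) measurable
  show "\<exists>r\<in>{0<..<1}. \<forall>\<phi>\<in>bmeas unif3. \<forall>\<psi>\<in>bmeas unif3. \<forall>K\<ge>0.
     coord_holder \<eta> K \<phi> \<longrightarrow> coord_holder \<eta> K \<psi> \<longrightarrow> (\<exists>C>0. \<forall>n. Cor n g \<phi> \<psi> unif3 \<le> C * r ^ n)"
    using r by (auto simp: Cor_swap intro!: bexI[of _ r] dec bf coord_holder_swap_xz)
qed

section \<open>Decay of correlations for \<open>f\<close> when \<open>p < 1 / 2\<close>\<close>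

text \<open>Iterating the transfer operator flattens \<open>u\<close> to its mean uniformly on the
  half-open square, while \<open>v\<close> enters through its bound \<open>B\<close> only. The
  constant \<open>C\<close> precedes \<open>v\<close>, so the estimate also applies to a
  \<open>v\<close> that varies with \<open>n\<close>.\<close>

lemma transfer_decay:
  assumes p: "p < 1 / 2" and \<eta>: "0 < \<eta>"
  obtains \<rho> where "0 < \<rho>" "\<rho> < 1" and "\<And>K u. K \<ge> 0 \<Longrightarrow> u \<in> bmeas unif2 \<Longrightarrow>
    (\<And>s t x. s \<in> {0..<1} \<Longrightarrow> t \<in> {0..<1} \<Longrightarrow> x \<in> {0..<1} \<Longrightarrow>
      \<bar>u (s, x) - u (t, x)\<bar> \<le> K * \<bar>s - t\<bar> powr \<eta> \<and> \<bar>u (x, s) - u (x, t)\<bar> \<le> K * \<bar>s - t\<bar> powr \<eta>) \<Longrightarrow>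
    \<exists>C\<ge>0. \<forall>v\<in>bmeas unif2. \<forall>B n. (\<forall>w. \<bar>v w\<bar> \<le> B) \<longrightarrow>
      \<bar>(\<integral>w. u (fst w) * v ((f ^^ n) (fst w)) \<partial>unif3) - (\<integral>w. u (fst w) \<partial>unif3) * (\<integral>w. v (fst w) \<partial>unif3)\<bar>
        \<le> C * B * \<rho> ^ n"
proof -
  \<comment> \<open>For \<open>p < 1 / 2\<close> the factor
    \<open>p / \<theta> + (1 - p) * \<theta>\<close> is below 1 when
    \<open>p / (1 - p) < \<theta> < 1\<close>, and \<open>1 / (2 * (1 - p))\<close> lies in this
    range. The other entry of the maximum makes a Hoelder function of \<open>y\<close> vary by at
    most a multiple of \<open>\<theta> ^ N\<close> on cylinders of level \<open>N\<close>.\<close>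
  define \<theta> where "\<theta> = max ((1 / real m) powr \<eta>) (1 / (2 * (1 - p)))"
  define s where "s = p / \<theta> + (1 - p) * \<theta>"
  define \<rho> where "\<rho> = max (kappa powr \<eta>) s"
  have "(1 / real m) powr \<eta> < 1 powr \<eta>"
    using m_ge \<eta> by (intro powr_less_mono2) auto
  then have \<theta>: "0 < \<theta>" "\<theta> < 1" "1 / (2 * (1 - p)) \<le> \<theta>" "(1 / real m) powr \<eta> \<le> \<theta>"
    using p p_bounds m_pos by (auto simp: \<theta>_def less_max_iff_disj)
  have "p < (1 - p) * \<theta>"
  proof -
    have "(1 - p) * (1 / (2 * (1 - p))) = 1 / 2" using p_bounds by (simp add: field_simps)
    then have "p < (1 - p) * (1 / (2 * (1 - p)))" using p by linarith
    also have "\<dots> \<le> (1 - p) * \<theta>" using \<theta>(3) p_bounds by (intro mult_left_mono) auto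
    finally show ?thesis .
  qed
  \<comment> \<open>This product is a factorisation of
    \<open>\<theta> - p - (1 - p) * \<theta> * \<theta>\<close>, that is, of
    \<open>\<theta> * (1 - s)\<close>.\<close>
  then have "0 < (1 - \<theta>) * ((1 - p) * \<theta> - p)" using \<theta> by simp
  then have "p + (1 - p) * \<theta> * \<theta> < \<theta>" by (simp add: algebra_simps)
  then have "s < 1" using \<theta>(1) by (simp add: s_def field_simps)
  \<comment> \<open>The strict gap keeps the denominator in the choice of \<open>A\<close> below
    positive.\<close>
  have s_gt: "p + (1 - p) * \<theta> < s"
    using \<theta> p_bounds by (simp add: s_def less_divide_eq)
  have kap: "0 < kappa powr \<eta>" "kappa powr \<eta> < 1"
    using kappa_bounds \<eta> powr_less_mono2[of \<eta> kappa 1] by auto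
  have \<rho>: "0 < \<rho>" "\<rho> < 1" "kappa powr \<eta> \<le> \<rho>" "p / \<theta> + (1 - p) * \<theta> \<le> \<rho>" "p + (1 - p) * \<theta> < \<rho>"
    using kap \<open>s < 1\<close> s_gt by (auto simp: \<rho>_def s_def less_max_iff_disj)
  show ?thesis
  proof (rule that[OF \<rho>(1,2)])
    fix K u
    assume K: "K \<ge> (0::real)" and u: "u \<in> bmeas unif2" and hol:
      "\<And>s t x. s \<in> {0..<1} \<Longrightarrow> t \<in> {0..<1} \<Longrightarrow> x \<in> {0..<1} \<Longrightarrow>
      \<bar>u (s, x) - u (t, x)\<bar> \<le> K * \<bar>s - t\<bar> powr \<eta> \<and> \<bar>u (x, s) - u (x, t)\<bar> \<le> K * \<bar>s - t\<bar> powr \<eta>"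
    \<comment> \<open>large enough to absorb the \<open>x\<close>-oscillation entering at cylinder level 0\<close>
    define A where "A = max K (p * K / (\<rho> - (p + (1 - p) * \<theta>)))"
    have A: "K \<le> A" "0 \<le> A" using K by (auto simp: A_def)
    have "p * K / (\<rho> - (p + (1 - p) * \<theta>)) \<le> A" by (simp add: A_def)
    then have A_ineq: "(p + (1 - p) * \<theta>) * A + p * K \<le> \<rho> * A"
      using \<rho>(5) by (simp add: divide_le_eq algebra_simps)
    \<comment> \<open>Both constants shrink by the same factor \<rho>, so the homogeneous inequality
      \<open>A_ineq\<close> persists from one iterate to the next.\<close>
    have "regular \<eta> \<theta> (\<rho> ^ n * A) (\<rho> ^ n * K) ((transfer ^^ n) u)" for n
    proof (induction n)
      case 0
      have "\<bar>u (x, y) - u (x, y')\<bar> \<le> A * \<theta> ^ N"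
        if "x \<in> {0..<1}" "y \<in> {0..<1}" "y' \<in> {0..<1}" "same_digits m N y y'" for x y y' N
      proof -
        have "\<bar>u (x, y) - u (x, y')\<bar> \<le> K * \<bar>y - y'\<bar> powr \<eta>" using hol that by blast
        also have "\<bar>y - y'\<bar> powr \<eta> \<le> ((1 / real m) ^ N) powr \<eta>"
          using same_digits_dist[OF m_pos(1) that(2-4)] \<eta> by (intro powr_mono2) auto
        also have "((1 / real m) ^ N) powr \<eta> = ((1 / real m) powr \<eta>) ^ N"
          using m_pos by (simp add: powr_powr powr_realpow[symmetric] mult.commute powr_power)
        also have "\<dots> \<le> \<theta> ^ N" using \<theta>(4) by (intro power_mono) auto
        finally have "\<bar>u (x, y) - u (x, y')\<bar> \<le> K * \<theta> ^ N" using K by (simp add: mult_left_mono)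
        also have "\<dots> \<le> A * \<theta> ^ N" using A \<theta> by (intro mult_right_mono) auto
        finally show ?thesis .
      qed
      then show ?case using hol by (simp add: regular_def)
    next
      case (Suc n)
      have "(p + (1 - p) * \<theta>) * (\<rho> ^ n * A) + p * (\<rho> ^ n * K) \<le> \<rho> * (\<rho> ^ n * A)"
        using mult_left_mono[OF A_ineq, of "\<rho> ^ n"] \<rho>(1) by (simp add: algebra_simps)
      then show ?case
        using regular_transfer[OF Suc \<theta>(1) \<eta> _ _ \<rho>(3,4)] A K \<rho>(1) by (simp add: mult.assoc)
    qed
    note reg = this
    have main: "\<bar>(\<integral>w. u (fst w) * v ((f ^^ n) (fst w)) \<partial>unif3) - (\<integral>w. u (fst w) \<partial>unif3) * (\<integral>w. v (fst w) \<partial>unif3)\<bar>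
        \<le> (A + K) * B * \<rho> ^ n" if v: "v \<in> bmeas unif2" and B: "\<forall>w. \<bar>v w\<bar> \<le> B" for v B n
    proof -
      let ?P = "(transfer ^^ n) u"
      define c where "c = (\<integral>w. u (fst w) \<partial>unif3)"
      have P: "?P \<in> bmeas unif2" by (rule transfer_pow_bmeas[OF u])
      have iP: "integrable unif3 (\<lambda>w. ?P (fst w))" by (rule unif3.P.bmeas_integrable[OF bmeas_fst[OF P]])
      \<comment> \<open>Duality against the constant function 1: the operator preserves
        integrals.\<close>
      have c: "c = (\<integral>w. ?P (fst w) \<partial>unif3)"
        using transfer_pow_dual[OF u bmeas_const[of 1], of n] by (simp add: c_def)
      \<comment> \<open>A value differs from the mean by at most the total oscillation, which decays
        like \<open>\<rho> ^ n\<close>.\<close>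
      have dev: "\<bar>?P (x, y) - c\<bar> \<le> \<rho> ^ n * A + \<rho> ^ n * K" if xy: "x \<in> {0..<1}" "y \<in> {0..<1}" for x y
      proof -
        have "?P (x, y) - c = (\<integral>w. ?P (x, y) - ?P (fst w) \<partial>unif3)"
          using iP by (simp add: c unif3.P.prob_space)
        also have "\<bar>\<dots>\<bar> \<le> \<rho> ^ n * A + \<rho> ^ n * K"
        proof (rule unif3.P.abs_expectation_le)
          show "(\<lambda>w. ?P (x, y) - ?P (fst w)) \<in> borel_measurable unif3"
            using iP by simp
          show "AE w in unif3. \<bar>?P (x, y) - ?P (fst w)\<bar> \<le> \<rho> ^ n * A + \<rho> ^ n * K"
          proof (rule eventually_mono[OF AE_unif3])
            fix w assume "w \<in> half_open_cube"
            then show "\<bar>?P (x, y) - ?P (fst w)\<bar> \<le> \<rho> ^ n * A + \<rho> ^ n * K"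
            proof (cases rule: half_open_cube_E)
              case (1 x' y' z')
              then show ?thesis
                using regular_osc[OF reg[of n] _ \<eta>, of x y x' y'] xy K \<rho>(1) by simp
            qed
          qed
        qed
        finally show ?thesis .
      qed
      have "(\<integral>w. u (fst w) * v ((f ^^ n) (fst w)) \<partial>unif3) - c * (\<integral>w. v (fst w) \<partial>unif3) =
          (\<integral>w. (?P (fst w) - c) * v (fst w) \<partial>unif3)"
        unfolding transfer_pow_dual[OF u v] left_diff_distrib
        by (subst Bochner_Integration.integral_diff)
           (auto intro!: unif3.P.bmeas_integrable bmeas_mult bmeas_const bmeas_fst P v)
      also have "\<bar>\<dots>\<bar> \<le> (\<rho> ^ n * A + \<rho> ^ n * K) * B"
      proof (rule unif3.P.abs_expectation_le)
        show "(\<lambda>w. (?P (fst w) - c) * v (fst w)) \<in> borel_measurable unif3"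
          using bmeas_measurable[OF bmeas_fst[OF P]] bmeas_measurable[OF bmeas_fst[OF v]] by simp
        show "AE w in unif3. \<bar>(?P (fst w) - c) * v (fst w)\<bar> \<le> (\<rho> ^ n * A + \<rho> ^ n * K) * B"
        proof (rule eventually_mono[OF AE_unif3])
          fix w assume "w \<in> half_open_cube"
          then obtain x y z where w: "w = ((x, y), z)" "x \<in> {0..<1}" "y \<in> {0..<1}"
            by (rule half_open_cube_E)
          show "\<bar>(?P (fst w) - c) * v (fst w)\<bar> \<le> (\<rho> ^ n * A + \<rho> ^ n * K) * B"
            unfolding abs_mult
            using w(1) dev[OF w(2,3)] B A K \<rho>(1) by (intro mult_mono) auto
        qed
      qed
      finally show ?thesis by (simp add: c_def algebra_simps)
    qed
    show "\<exists>C\<ge>0. \<forall>v\<in>bmeas unif2. \<forall>B n. (\<forall>w. \<bar>v w\<bar> \<le> B) \<longrightarrow>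
      \<bar>(\<integral>w. u (fst w) * v ((f ^^ n) (fst w)) \<partial>unif3) - (\<integral>w. u (fst w) \<partial>unif3) * (\<integral>w. v (fst w) \<partial>unif3)\<bar>
        \<le> C * B * \<rho> ^ n"
      using main A K by (intro exI[of _ "A + K"]) simp
  qed
qed

end

context baker
begin

section \<open>Decay of correlations for \<open>g\<close>\<close>

text \<open>The branch taken and the new \<open>(x, y)\<close> do not depend on \<open>z\<close>, so
  both orbits follow the same branches and their \<open>z\<close>-distance shrinks by at least
  \<open>kappa\<close> at every step.\<close>

lemma g_z_contracts:
  assumes "(q, z) \<in> half_open_cube" "(q, z') \<in> half_open_cube"
  shows "fst ((g ^^ n) (q, z)) = fst ((g ^^ n) (q, z')) \<and>
    \<bar>snd ((g ^^ n) (q, z)) - snd ((g ^^ n) (q, z'))\<bar> \<le> kappa ^ n"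
proof (induction n)
  case 0
  then show ?case using assms by (auto simp: half_open_cube_def)
next
  case (Suc n)
  obtain x y t t' where eq: "(g ^^ n) (q, z) = ((x, y), t)" "(g ^^ n) (q, z') = ((x, y), t')"
    using Suc by (metis prod.collapse)
  have pq: "(1 - p) / real m \<le> kappa" using div_m_le[of "1 - p"] kappa_bounds p_bounds by linarith
  have k: "\<bar>(c + k * t) - (c + k * t')\<bar> \<le> kappa * kappa ^ n" if "0 \<le> k" "k \<le> kappa" for c k
  proof -
    have "\<bar>(c + k * t) - (c + k * t')\<bar> = k * \<bar>t - t'\<bar>"
      using that by (simp add: abs_mult flip: right_diff_distrib)
    also have "\<dots> \<le> kappa * kappa ^ n" using that eq Suc by (intro mult_mono) auto
    finally show ?thesis .
  qed
  show ?case using k[of p] k[of "(1 - p) / real m"] pq kappa_bounds p_bounds m_pos by (simp add: eq)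
qed

lemma exp_decay_contracting:
  assumes p: "p < 1 / 2"
  shows "exp_decay g"
  unfolding exp_decay_def
proof (intro allI impI)
  fix \<eta> :: real assume \<eta>: "\<eta> > 0"
  obtain \<rho> where \<rho>: "0 < \<rho>" "\<rho> < 1" and dec: "\<And>K u. K \<ge> 0 \<Longrightarrow> u \<in> bmeas unif2 \<Longrightarrow>
    (\<And>s t x. s \<in> {0..<1} \<Longrightarrow> t \<in> {0..<1} \<Longrightarrow> x \<in> {0..<1} \<Longrightarrow>
      \<bar>u (s, x) - u (t, x)\<bar> \<le> K * \<bar>s - t\<bar> powr \<eta> \<and> \<bar>u (x, s) - u (x, t)\<bar> \<le> K * \<bar>s - t\<bar> powr \<eta>) \<Longrightarrow>
    \<exists>C\<ge>0. \<forall>v\<in>bmeas unif2. \<forall>B n. (\<forall>w. \<bar>v w\<bar> \<le> B) \<longrightarrow>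
      \<bar>(\<integral>w. u (fst w) * v ((f ^^ n) (fst w)) \<partial>unif3) - (\<integral>w. u (fst w) \<partial>unif3) * (\<integral>w. v (fst w) \<partial>unif3)\<bar>
        \<le> C * B * \<rho> ^ n"
    by (rule transfer_decay[OF p \<eta>]) blast
  \<comment> \<open>\<open>r0\<close> dominates both rates. Each mechanism has only about half of
    the \<open>n\<close> steps at its disposal, hence the square root.\<close>
  define r0 where "r0 = max \<rho> (kappa powr \<eta>)"
  define r where "r = sqrt r0"
  have "kappa powr \<eta> < 1"
    using kappa_bounds \<eta> powr_less_mono2[of \<eta> kappa 1] by auto
  then have r0: "0 < r0" "r0 < 1" "\<rho> \<le> r0" "kappa powr \<eta> \<le> r0"
    using \<rho> by (auto simp: r0_def)
  then have r: "0 < r" "r < 1" by (auto simp: r_def)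
  have r_sq: "r0 ^ k = r ^ (2 * k)" for k
    using r0 by (simp add: r_def power_mult)
  have "\<exists>C>0. \<forall>n. Cor n g \<phi> \<psi> unif3 \<le> C * r ^ n"
    if \<phi>: "\<phi> \<in> bmeas unif3" and \<psi>: "\<psi> \<in> bmeas unif3" and K: "K \<ge> 0"
      and \<phi>h: "coord_holder \<eta> K \<phi>" and \<psi>h: "coord_holder \<eta> K \<psi>" for \<phi> \<psi> K
  proof -
    obtain B\<phi> where B\<phi>: "B\<phi> > 0" "\<And>w. \<bar>\<phi> w\<bar> \<le> B\<phi>" using bmeas_bound[OF \<phi>] by blast
    obtain B\<psi> where B\<psi>: "B\<psi> > 0" "\<And>w. \<bar>\<psi> w\<bar> \<le> B\<psi>" using bmeas_bound[OF \<psi>] by blast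
    have c\<psi>: "(\<lambda>w. \<psi> (k w)) \<in> bmeas M" if "k \<in> M \<rightarrow>\<^sub>M unif3" for k and M :: "'c measure"
      using \<psi> that by (rule bmeas_comp)
    \<comment> \<open>The conditional expectation of \<phi> given \<open>(x, y)\<close>: it inherits
      the Hoelder bound and replaces \<phi> in integrals against functions of
      \<open>(x, y)\<close>.\<close>
    define u where "u = (\<lambda>q. \<integral>z. \<phi> (q, z) \<partial>unif)"
    have u: "u \<in> bmeas unif2" unfolding u_def by (rule unif.bmeas_partial[OF \<phi>])
    have u_int: "(\<integral>w. \<phi> w * h (fst w) \<partial>unif3) = (\<integral>w. u (fst w) * h (fst w) \<partial>unif3)"
      if h: "h \<in> bmeas unif2" for h
    proof -
      have "(\<integral>w. \<phi> w * h (fst w) \<partial>unif3) = (\<integral>q. u q * h q \<partial>unif2)"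
        using unif3.integral_fst'[OF unif3.P.bmeas_integrable[OF bmeas_mult[OF \<phi> bmeas_fst[OF h]]]]
        by (simp add: u_def)
      also have "\<dots> = (\<integral>w. u (fst w) * h (fst w) \<partial>unif3)"
        by (rule integral_fst_unif3[OF bmeas_mult[OF u h], symmetric])
      finally show ?thesis .
    qed
    have u_diff: "\<bar>u q - u q'\<bar> \<le> E" if "\<And>z. z \<in> {0..<1} \<Longrightarrow> \<bar>\<phi> (q, z) - \<phi> (q', z)\<bar> \<le> E" for q q' E
    proof -
      have sec: "(\<lambda>z. \<phi> (q, z)) \<in> bmeas unif" for q
        by (rule unif.bmeas_section[OF \<phi>]) (simp add: space_pair_measure)
      have "u q - u q' = (\<integral>z. \<phi> (q, z) - \<phi> (q', z) \<partial>unif)"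
        unfolding u_def
        by (rule Bochner_Integration.integral_diff[symmetric]) (intro unif.bmeas_integrable sec)+
      also have "\<bar>\<dots>\<bar> \<le> E"
      proof (rule unif.abs_expectation_le)
        show "(\<lambda>z. \<phi> (q, z) - \<phi> (q', z)) \<in> borel_measurable unif"
          using sec[of q] sec[of q'] by (intro borel_measurable_diff bmeas_measurable)
        show "AE z in unif. \<bar>\<phi> (q, z) - \<phi> (q', z)\<bar> \<le> E"
          by (rule eventually_mono[OF AE_unif]) (rule that)
      qed
      finally show ?thesis .
    qed
    have "\<bar>u (s, x) - u (t, x)\<bar> \<le> K * \<bar>s - t\<bar> powr \<eta> \<and> \<bar>u (x, s) - u (x, t)\<bar> \<le> K * \<bar>s - t\<bar> powr \<eta>"
      if "s \<in> {0..<1}" "t \<in> {0..<1}" "x \<in> {0..<1}" for s t x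
      using that \<phi>h unfolding coord_holder_def by (auto intro!: u_diff)
    from dec[OF K u this] obtain C where C: "C \<ge> 0" and
      decC: "\<And>v B n. v \<in> bmeas unif2 \<Longrightarrow> (\<And>w. \<bar>v w\<bar> \<le> B) \<Longrightarrow>
        \<bar>(\<integral>w. u (fst w) * v ((f ^^ n) (fst w)) \<partial>unif3) - (\<integral>w. u (fst w) \<partial>unif3) * (\<integral>w. v (fst w) \<partial>unif3)\<bar>
          \<le> C * B * \<rho> ^ n"
      by blast
    \<comment> \<open>The first term collects two replacements of \<psi> composed with
      \<open>g ^^ k\<close> by \<open>v\<close>, the second is the decay for \<open>f\<close>, and
      the 1 ensures positivity even if \<open>K\<close> and \<open>C\<close> vanish.\<close>
    have "Cor n g \<phi> \<psi> unif3 \<le> (2 * B\<phi> * K / r + C * B\<psi> + 1) * r ^ n" for n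
    proof -
      define k where "k = n div 2"
      define l where "l = n - k"
      have n: "n = k + l" "n \<le> 2 * l" "n \<le> 2 * k + 1" by (auto simp: k_def l_def)
      \<comment> \<open>After \<open>k\<close> steps the starting height hardly matters, so the
        height 0 stands for all. The bound of \<open>v\<close> is that of \<psi>, uniformly in
        \<open>k\<close>.\<close>
      define v where "v = (\<lambda>q. \<psi> ((g ^^ k) (q, 0)))"
      have v: "v \<in> bmeas unif2" unfolding v_def by (rule c\<psi>) measurable
      define \<delta> where "\<delta> = K * r0 ^ k"
      have \<delta>: "\<bar>\<psi> ((g ^^ k) w) - v (fst w)\<bar> \<le> \<delta>" if "w \<in> half_open_cube" for w
      proof -
        obtain q z where w: "w = (q, z)" by (cases w)
        have mem: "(q, z) \<in> half_open_cube" "(q, 0) \<in> half_open_cube"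
          using that by (auto simp: w half_open_cube_def)
        obtain x y t t' where eq: "(g ^^ k) (q, z) = ((x, y), t)" "(g ^^ k) (q, 0) = ((x, y), t')"
          and tt: "\<bar>t - t'\<bar> \<le> kappa ^ k"
          using g_z_contracts[OF mem, of k] by (metis prod.collapse snd_conv)
        have "\<bar>\<psi> ((x, y), t) - \<psi> ((x, y), t')\<bar> \<le> K * \<bar>t - t'\<bar> powr \<eta>"
          using g_pow_mem[OF mem(1), of k] g_pow_mem[OF mem(2), of k] \<psi>h
          unfolding eq coord_holder_def by (auto simp: half_open_cube_def)
        also have "\<dots> \<le> K * (kappa ^ k) powr \<eta>"
          using K \<eta> tt by (intro mult_left_mono powr_mono2) auto
        also have "(kappa ^ k) powr \<eta> = (kappa powr \<eta>) ^ k"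
          using kappa_bounds by (simp add: powr_powr powr_realpow[symmetric] mult.commute powr_power)
        also have "K * \<dots> \<le> \<delta>"
          unfolding \<delta>_def using K r0 by (intro mult_left_mono power_mono) auto
        finally show ?thesis by (simp add: w v_def eq)
      qed
      define I where "I = (\<integral>w. \<phi> w * v ((f ^^ l) (fst w)) \<partial>unif3)"
      have vl: "(\<lambda>q. v ((f ^^ l) q)) \<in> bmeas unif2" using v by (rule bmeas_comp) measurable
      have step1: "\<bar>(\<integral>w. \<phi> w * \<psi> ((g ^^ n) w) \<partial>unif3) - I\<bar> \<le> B\<phi> * \<delta>"
      proof -
        have b1: "(\<lambda>w. \<phi> w * \<psi> ((g ^^ n) w)) \<in> bmeas unif3"
          by (intro bmeas_mult \<phi> c\<psi>) measurable
        have b2: "(\<lambda>w. \<phi> w * v ((f ^^ l) (fst w))) \<in> bmeas unif3"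
          by (intro bmeas_mult \<phi> bmeas_fst vl)
        have "(\<integral>w. \<phi> w * \<psi> ((g ^^ n) w) \<partial>unif3) - I =
            (\<integral>w. \<phi> w * \<psi> ((g ^^ n) w) - \<phi> w * v ((f ^^ l) (fst w)) \<partial>unif3)"
          unfolding I_def
          by (rule Bochner_Integration.integral_diff[symmetric]) (intro unif3.P.bmeas_integrable b1 b2)+
        also have "\<bar>\<dots>\<bar> \<le> B\<phi> * \<delta>"
        proof (rule unif3.P.abs_expectation_le)
          show "(\<lambda>w. \<phi> w * \<psi> ((g ^^ n) w) - \<phi> w * v ((f ^^ l) (fst w))) \<in> borel_measurable unif3"
            by (intro borel_measurable_diff bmeas_measurable b1 b2)
          show "AE w in unif3. \<bar>\<phi> w * \<psi> ((g ^^ n) w) - \<phi> w * v ((f ^^ l) (fst w))\<bar> \<le> B\<phi> * \<delta>"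
          proof (rule eventually_mono[OF AE_unif3])
            fix w assume "w \<in> half_open_cube"
            from \<delta>[OF g_pow_mem[OF this, of l]]
            have "\<bar>\<psi> ((g ^^ n) w) - v ((f ^^ l) (fst w))\<bar> \<le> \<delta>"
              by (simp add: n(1) funpow_add fst_g_pow)
            then show "\<bar>\<phi> w * \<psi> ((g ^^ n) w) - \<phi> w * v ((f ^^ l) (fst w))\<bar> \<le> B\<phi> * \<delta>"
              unfolding right_diff_distrib[symmetric] abs_mult using B\<phi> by (intro mult_mono) auto
          qed
        qed
        finally show ?thesis .
      qed
      have step2: "\<bar>I - (\<integral>w. \<phi> w \<partial>unif3) * (\<integral>w. v (fst w) \<partial>unif3)\<bar> \<le> C * B\<psi> * \<rho> ^ l"
        using decC[OF v, of B\<psi> l] B\<psi> u_int[OF vl] u_int[OF bmeas_const[of 1]] by (simp add: I_def v_def)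
      have step3: "\<bar>(\<integral>w. \<phi> w \<partial>unif3) * (\<integral>w. v (fst w) \<partial>unif3) - (\<integral>w. \<phi> w \<partial>unif3) * (\<integral>w. \<psi> w \<partial>unif3)\<bar> \<le> B\<phi> * \<delta>"
      proof -
        have bk: "(\<lambda>w. \<psi> ((g ^^ k) w)) \<in> bmeas unif3" by (rule c\<psi>) measurable
        have "(\<integral>w. v (fst w) \<partial>unif3) - (\<integral>w. \<psi> w \<partial>unif3) = (\<integral>w. v (fst w) - \<psi> ((g ^^ k) w) \<partial>unif3)"
          unfolding integral_g_pow[OF \<psi>, of k, symmetric]
          by (rule Bochner_Integration.integral_diff[symmetric])
             (intro unif3.P.bmeas_integrable bk bmeas_fst v)+
        also have "\<bar>\<dots>\<bar> \<le> \<delta>"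
        proof (rule unif3.P.abs_expectation_le)
          show "(\<lambda>w. v (fst w) - \<psi> ((g ^^ k) w)) \<in> borel_measurable unif3"
            by (intro borel_measurable_diff bmeas_measurable bk bmeas_fst v)
          show "AE w in unif3. \<bar>v (fst w) - \<psi> ((g ^^ k) w)\<bar> \<le> \<delta>"
            by (rule eventually_mono[OF AE_unif3]) (use \<delta> in \<open>simp add: abs_minus_commute\<close>)
        qed
        finally have 1: "\<bar>(\<integral>w. v (fst w) \<partial>unif3) - (\<integral>w. \<psi> w \<partial>unif3)\<bar> \<le> \<delta>" .
        have 2: "\<bar>\<integral>w. \<phi> w \<partial>unif3\<bar> \<le> B\<phi>"
          using B\<phi> \<phi> by (intro unif3.P.abs_expectation_le) (auto intro: bmeas_measurable)
        show ?thesis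
          unfolding right_diff_distrib[symmetric] abs_mult using 1 2 B\<phi> by (intro mult_mono) auto
      qed
      \<comment> \<open>For odd \<open>n\<close>, \<open>2 * k\<close> is \<open>n - 1\<close>; the
        extra factor \<open>r\<close> compensates for the rounding.\<close>
      have "r0 ^ k * r \<le> r ^ n"
        using r power_decreasing[of n "Suc (2 * k)" r] n(3) by (simp add: r_sq mult.commute)
      then have "r0 ^ k \<le> r ^ n / r" using r by (simp add: pos_le_divide_eq)
      then have "2 * B\<phi> * \<delta> \<le> 2 * B\<phi> * (K * (r ^ n / r))"
        unfolding \<delta>_def using B\<phi> K by (intro mult_left_mono) auto
      moreover have "\<rho> ^ l \<le> r ^ n"
      proof -
        have "\<rho> ^ l \<le> r0 ^ l" using r0 \<rho> by (intro power_mono) auto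
        also have "\<dots> \<le> r ^ n" using r power_decreasing[of n "2 * l" r] n(2) by (simp add: r_sq)
        finally show ?thesis .
      qed
      then have "C * B\<psi> * \<rho> ^ l \<le> C * B\<psi> * r ^ n" using C B\<psi> by (intro mult_left_mono) auto
      moreover have "Cor n g \<phi> \<psi> unif3 \<le> 2 * B\<phi> * \<delta> + C * B\<psi> * \<rho> ^ l"
        using step1 step2 step3 by (simp add: Cor_def)
      moreover have "0 \<le> r ^ n" using r by simp
      ultimately show ?thesis by (simp add: algebra_simps)
    qed
    moreover have "2 * B\<phi> * K / r + C * B\<psi> + 1 > 0"
      using B\<phi> B\<psi> K C r by (intro add_nonneg_pos add_nonneg_nonneg) auto
    ultimately show ?thesis by blast
  qed
  then show "\<exists>r\<in>{0<..<1}. \<forall>\<phi>\<in>bmeas unif3. \<forall>\<psi>\<in>bmeas unif3. \<forall>K\<ge>0.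
     coord_holder \<eta> K \<phi> \<longrightarrow> coord_holder \<eta> K \<psi> \<longrightarrow> (\<exists>C>0. \<forall>n. Cor n g \<phi> \<psi> unif3 \<le> C * r ^ n)"
    using r by (intro bexI[of _ r]) auto
qed

lemma exp_decay_g:
  assumes "p \<noteq> 1 / 2"
  shows "exp_decay g"
proof (cases "p < 1 / 2")
  case False
  interpret S: baker m "1 - p" brz cz brx cx by (rule swap)
  show ?thesis using assms False by (intro exp_decay_swap S.exp_decay_contracting) auto
qed (rule exp_decay_contracting)

end

section \<open>From the half-open to the closed cube\<close>

text \<open>Hoelder functions are continuous, so extension by zero from the closed set
  \<open>C\<close> is Borel, and compactness supplies the bound.\<close>

lemma Holder_bmeas:
  fixes C :: "'a::euclidean_space set"
  assumes "compact C" "\<eta> > 0" "\<phi> \<in> Holder \<eta> C"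
  shows "(\<lambda>x. indicator C x * \<phi> x) \<in> bmeas borel"
proof -
  obtain K where K: "K \<ge> 0" "\<And>x y. x \<in> C \<Longrightarrow> y \<in> C \<Longrightarrow> \<bar>\<phi> x - \<phi> y\<bar> \<le> K * dist x y powr \<eta>"
    using assms(3) by (auto simp: Holder_def)
  have "continuous_on C \<phi>"
    unfolding continuous_on_def
  proof
    fix x assume x: "x \<in> C"
    have "((\<lambda>y. dist y x) \<longlongrightarrow> 0) (at x within C)"
      using tendsto_dist_iff[THEN iffD1, OF tendsto_ident_at] .
    from tendsto_powr'[OF this tendsto_const, of \<eta>]
    have "((\<lambda>y. dist y x powr \<eta>) \<longlongrightarrow> 0) (at x within C)" using assms(2) by simp
    then have lim: "((\<lambda>y. K * dist y x powr \<eta>) \<longlongrightarrow> 0) (at x within C)"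
      by (rule tendsto_mult_right_zero)
    have "\<forall>\<^sub>F y in at x within C. norm (\<phi> y - \<phi> x) \<le> K * dist y x powr \<eta>"
      using K(2) x by (auto simp: eventually_at_filter)
    from Lim_null_comparison[OF this lim]
    show "(\<phi> \<longlongrightarrow> \<phi> x) (at x within C)" by (rule LIM_zero_cancel)
  qed
  then have meas: "(\<lambda>x. indicator C x * \<phi> x) \<in> borel_measurable borel"
    using borel_measurable_continuous_on_indicator[of C \<phi>] compact_imp_closed[OF assms(1)] by simp
  have "bounded (\<phi> ` C)"
    using compact_continuous_image[OF \<open>continuous_on C \<phi>\<close> assms(1)] by (rule compact_imp_bounded)
  then obtain B where "B > 0" "\<And>x. x \<in> C \<Longrightarrow> \<bar>\<phi> x\<bar> \<le> B"
    unfolding bounded_pos by auto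
  then show ?thesis using meas by (intro bmeasI[where B=B]) (auto simp: indicator_def)
qed

text \<open>Moves from a total map \<open>T0\<close> and a measure given by a density to a map
  \<open>T\<close> on the restricted measure. Agreement on \<open>C\<close> suffices, since
  \<open>T0\<close> maps \<open>C\<close> into itself.\<close>

lemma exponentially_mixingI:
  fixes C :: "'a::euclidean_space set"
  assumes C: "compact C" and M: "M = density lborel (indicator C)" "prob_space M"
    and T0 [measurable]: "T0 \<in> borel \<rightarrow>\<^sub>M borel" and T0_C: "\<And>x. x \<in> C \<Longrightarrow> T0 x \<in> C"
    and T: "\<And>x. x \<in> C \<Longrightarrow> T x = T0 x" and inv: "distr M M T0 = M"
    and decay: "\<And>\<eta>. 0 < \<eta> \<Longrightarrow> \<exists>r\<in>{0<..<1}. \<forall>\<phi>\<in>bmeas borel \<inter> Holder \<eta> C. \<forall>\<psi>\<in>bmeas borel \<inter> Holder \<eta> C.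
      \<exists>B>0. \<forall>n. Cor n T0 \<phi> \<psi> M \<le> B * r ^ n"
  shows "exponentially_mixing T (restrict_space lborel C)"
proof -
  let ?\<nu> = "restrict_space lborel C"
  have Cb [measurable]: "C \<in> sets borel" using compact_imp_closed[OF C] by simp
  have sets_M: "sets M = sets borel" and space_M: "space M = UNIV" by (simp_all add: M)
  have space_\<nu>: "space ?\<nu> = C" by (simp add: space_restrict_space)
  have em: "emeasure ?\<nu> A = emeasure M A" if "A \<in> sets borel" "A \<subseteq> C" for A
  proof -
    have "emeasure M A = (\<integral>\<^sup>+ x. indicator C x * indicator A x \<partial>lborel)"
      using that(1) by (simp add: M emeasure_density)
    also have "\<dots> = (\<integral>\<^sup>+ x. indicator A x \<partial>lborel)"
      by (rule nn_integral_cong) (use that(2) in \<open>auto simp: indicator_def\<close>)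
    finally show ?thesis using that by (simp add: emeasure_restrict_space)
  qed
  have emC: "emeasure M C = 1"
  proof -
    have "AE x in M. x \<in> C" unfolding M by (subst AE_density) (auto simp: indicator_def)
    then show ?thesis
      using prob_space.emeasure_eq_1_AE[OF M(2), of C] Cb by (simp add: sets_M)
  qed
  have int: "(\<integral>x. h x \<partial>?\<nu>) = (\<integral>x. h0 x \<partial>M)"
    if "h0 \<in> borel_measurable borel" "\<And>x. x \<in> C \<Longrightarrow> h x = h0 x" for h h0 :: "'a \<Rightarrow> real"
  proof -
    have "(\<integral>x. h x \<partial>?\<nu>) = (\<integral>x. h0 x \<partial>?\<nu>)"
      using that(2) by (intro Bochner_Integration.integral_cong) (simp_all add: space_\<nu>)
    also have "\<dots> = (\<integral>x. indicator C x *\<^sub>R h0 x \<partial>lborel)"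
      by (rule integral_restrict_space) simp
    also have "\<dots> = (\<integral>x. h0 x \<partial>M)"
      using integral_density[of h0 lborel "indicator C"] that(1) by (simp add: M ennreal_indicator)
    finally show ?thesis .
  qed
  have pow: "(T0 ^^ n) x \<in> C \<and> (T ^^ n) x = (T0 ^^ n) x" if "x \<in> C" for x n
    by (induction n) (use that T T0_C in auto)
  have T_meas: "T \<in> ?\<nu> \<rightarrow>\<^sub>M ?\<nu>"
  proof (rule measurable_restrict_space2)
    show "T \<in> space ?\<nu> \<rightarrow> C" using T T0_C by (simp add: space_\<nu>)
    have "T0 \<in> ?\<nu> \<rightarrow>\<^sub>M lborel" by (rule measurable_restrict_space1) simp
    then show "T \<in> ?\<nu> \<rightarrow>\<^sub>M lborel"
      using T by (subst measurable_cong[of ?\<nu> T T0]) (simp_all add: space_\<nu>)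
  qed
  have "borel_probability ?\<nu>"
    unfolding borel_probability_def
  proof
    show "prob_space ?\<nu>" using em[of C] emC by (intro prob_spaceI) (simp add: space_\<nu>)
    show "sets ?\<nu> = sets (restrict_space borel (space ?\<nu>))"
      by (simp add: space_\<nu> sets_restrict_space)
  qed
  moreover have "preserves_measure T ?\<nu>"
    unfolding preserves_measure_def
  proof (intro conjI T_meas measure_eqI)
    fix A assume "A \<in> sets (distr ?\<nu> ?\<nu> T)"
    then have A: "A \<in> sets ?\<nu>" by simp
    then have A': "A \<in> sets borel" "A \<subseteq> C"
      using sets_restrict_space_iff[of C lborel A] by auto
    have pre: "T -` A \<inter> C = T0 -` A \<inter> C" using T by auto
    have pre_meas: "T0 -` A \<inter> C \<in> sets borel"
      using measurable_sets[OF T0 A'(1)] Cb by auto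
    have "emeasure (distr ?\<nu> ?\<nu> T) A = emeasure ?\<nu> (T -` A \<inter> C)"
      by (simp add: emeasure_distr[OF T_meas A] space_\<nu>)
    also have "\<dots> = emeasure M (T0 -` A \<inter> C)"
      unfolding pre by (rule em[OF pre_meas]) auto
    \<comment> \<open>\<open>T0\<close> may send points outside \<open>C\<close> into
      \<open>A\<close>, but these points have no mass under \<open>M\<close>.\<close>
    also have "\<dots> = emeasure M (T0 -` A)"
    proof (rule emeasure_eq_AE)
      show "AE x in M. x \<in> T0 -` A \<inter> C \<longleftrightarrow> x \<in> T0 -` A"
        unfolding M by (subst AE_density) (auto simp: indicator_def)
      show "T0 -` A \<inter> C \<in> sets M" "T0 -` A \<in> sets M"
        using pre_meas measurable_sets[OF T0 A'(1)] by (simp_all add: sets_M)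
    qed
    also have "\<dots> = emeasure (distr M M T0) A"
      using A' by (subst emeasure_distr) (simp_all add: space_M sets_M measurable_cong_sets[OF sets_M sets_M])
    also have "\<dots> = emeasure ?\<nu> A" using A' by (simp add: inv em)
    finally show "emeasure (distr ?\<nu> ?\<nu> T) A = emeasure ?\<nu> A" .
  qed simp
  moreover have "\<exists>r\<in>{0<..<1}. \<forall>\<phi>\<in>Holder \<eta> (space ?\<nu>). \<forall>\<psi>\<in>Holder \<eta> (space ?\<nu>).
      \<exists>B>0. \<forall>n\<ge>1. Cor n T \<phi> \<psi> ?\<nu> \<le> B * r ^ n" if "\<eta> \<in> {0<..1}" for \<eta>
  proof -
    from that have "0 < \<eta>" by simp
    from decay[OF this] obtain r where r: "r \<in> {0<..<1}" and
      dec: "\<forall>\<phi>\<in>bmeas borel \<inter> Holder \<eta> C. \<forall>\<psi>\<in>bmeas borel \<inter> Holder \<eta> C.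
        \<exists>B>0. \<forall>n. Cor n T0 \<phi> \<psi> M \<le> B * r ^ n"
      by (rule bexE)
    have "\<exists>B>0. \<forall>n\<ge>1. Cor n T \<phi> \<psi> ?\<nu> \<le> B * r ^ n"
      if \<phi>: "\<phi> \<in> Holder \<eta> C" and \<psi>: "\<psi> \<in> Holder \<eta> C" for \<phi> \<psi>
    proof -
      \<comment> \<open>Extension by zero makes the observables bounded and Borel on the whole type;
        it changes nothing along orbits starting in \<open>C\<close>, which stay there.\<close>
      let ?\<phi> = "\<lambda>x. indicator C x * \<phi> x" and ?\<psi> = "\<lambda>x. indicator C x * \<psi> x"
      have b: "?\<phi> \<in> bmeas borel" "?\<psi> \<in> bmeas borel"
        by (rule Holder_bmeas[OF C \<open>0 < \<eta>\<close>]; fact)+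
      then have bm: "?\<phi> \<in> borel_measurable borel" "?\<psi> \<in> borel_measurable borel"
        by (simp_all add: bmeas_def)
      have "?\<phi> \<in> Holder \<eta> C" "?\<psi> \<in> Holder \<eta> C" using \<phi> \<psi> by (simp_all add: Holder_def)
      then obtain B where B: "B > 0" "\<forall>n. Cor n T0 ?\<phi> ?\<psi> M \<le> B * r ^ n"
        using dec[THEN bspec, THEN bspec, OF IntI IntI, OF b(1) _ b(2)] by blast
      have "Cor n T \<phi> \<psi> ?\<nu> = Cor n T0 ?\<phi> ?\<psi> M" for n
      proof -
        have "T0 ^^ n \<in> borel \<rightarrow>\<^sub>M borel" by (rule measurable_compose_n) simp
        from borel_measurable_times[OF bm(1) measurable_compose[OF this bm(2)]]
        have "(\<lambda>x. ?\<phi> x * ?\<psi> ((T0 ^^ n) x)) \<in> borel_measurable borel" .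
        then have "(\<integral>x. \<phi> x * \<psi> ((T ^^ n) x) \<partial>?\<nu>) = (\<integral>x. ?\<phi> x * ?\<psi> ((T0 ^^ n) x) \<partial>M)"
          by (rule int) (use pow in auto)
        moreover have "(\<integral>x. \<phi> x \<partial>?\<nu>) = (\<integral>x. ?\<phi> x \<partial>M)" "(\<integral>x. \<psi> x \<partial>?\<nu>) = (\<integral>x. ?\<psi> x \<partial>M)"
          by (rule int[OF bm(1)], simp) (rule int[OF bm(2)], simp)
        ultimately show ?thesis by (simp only: Cor_def)
      qed
      then show ?thesis using B by auto
    qed
    then show ?thesis unfolding space_\<nu> using r by blast
  qed
  ultimately show ?thesis unfolding exponentially_mixing_def by blast
qed

section \<open>Lebesgue measure and Hoelder functions on the closed square and cube\<close>

lemma unif2_density: "unif2 = density lborel (indicator unit_square)"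
proof -
  have "unif2 = density (lborel \<Otimes>\<^sub>M lborel) (\<lambda>(x, y). indicator {0..1} x * indicator {0..1} y)"
    unfolding unif_def
    by (rule pair_measure_density)
       (simp_all add: lborel.sigma_finite_measure_axioms prob_space_imp_sigma_finite prob_space_unif[unfolded unif_def])
  also have "(\<lambda>(x, y). indicator {0..1} x * indicator {0..1} y) = (indicator unit_square :: real \<times> real \<Rightarrow> ennreal)"
    by (auto simp: unit_square_def indicator_def fun_eq_iff)
  finally show ?thesis by (simp only: lborel_prod)
qed

lemma unif3_density: "unif3 = density lborel (indicator unit_cube)"
proof -
  have [measurable]: "unit_square \<in> sets borel"
    unfolding unit_square_def by (intro borel_closed closed_Times closed_atLeastAtMost)
  have "unif3 = density (lborel \<Otimes>\<^sub>M lborel) (\<lambda>(x, y). indicator unit_square x * indicator {0..1} y)"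
    unfolding unif2_density unfolding unif_def
    by (rule pair_measure_density)
       (simp_all add: lborel.sigma_finite_measure_axioms prob_space_imp_sigma_finite prob_space_unif[unfolded unif_def])
  also have "(\<lambda>(x, y). indicator unit_square x * indicator {0..1} y) = (indicator unit_cube :: point \<Rightarrow> ennreal)"
    by (auto simp: unit_cube_def indicator_def fun_eq_iff)
  finally show ?thesis by (simp only: lborel_prod)
qed

lemma compact_unit_square: "compact unit_square"
  unfolding unit_square_def by (intro compact_Times compact_Icc)

lemma compact_unit_cube: "compact unit_cube"
  unfolding unit_cube_def by (intro compact_Times compact_unit_square compact_Icc)

lemma bmeas_unif2: "bmeas unif2 = bmeas borel"
  unfolding bmeas_def using measurable_cong_sets[OF sets_unif2 refl] by blast

text \<open>For points differing in one coordinate the Euclidean distance is the distance in that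
  coordinate.\<close>

lemma Holder_coord_holder:
  assumes "h \<in> Holder \<eta> unit_cube"
  obtains K where "K \<ge> 0" "coord_holder \<eta> K h"
proof -
  obtain K where K: "K \<ge> 0"
    "\<And>v w. v \<in> unit_cube \<Longrightarrow> w \<in> unit_cube \<Longrightarrow> \<bar>h v - h w\<bar> \<le> K * dist v w powr \<eta>"
    using assms unfolding Holder_def by blast
  have "coord_holder \<eta> K h"
    unfolding coord_holder_def
  proof (intro ballI conjI)
    fix s t x y :: real assume "s \<in> {0..<1}" "t \<in> {0..<1}" "x \<in> {0..<1}" "y \<in> {0..<1}"
    then have mem: "((s, x), y) \<in> unit_cube" "((t, x), y) \<in> unit_cube" "((x, s), y) \<in> unit_cube"
      "((x, t), y) \<in> unit_cube" "((x, y), s) \<in> unit_cube" "((x, y), t) \<in> unit_cube"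
      by (auto simp: unit_cube_def unit_square_def)
    show "\<bar>h ((s, x), y) - h ((t, x), y)\<bar> \<le> K * \<bar>s - t\<bar> powr \<eta>"
      using K(2)[OF mem(1,2)] by (simp add: dist_Pair_Pair dist_real_def)
    show "\<bar>h ((x, s), y) - h ((x, t), y)\<bar> \<le> K * \<bar>s - t\<bar> powr \<eta>"
      using K(2)[OF mem(3,4)] by (simp add: dist_Pair_Pair dist_real_def)
    show "\<bar>h ((x, y), s) - h ((x, y), t)\<bar> \<le> K * \<bar>s - t\<bar> powr \<eta>"
      using K(2)[OF mem(5,6)] by (simp add: dist_Pair_Pair dist_real_def)
  qed
  then show ?thesis using that K(1) by blast
qed

lemma coord_holder_mono:
  assumes "coord_holder \<eta> K h" "K \<le> L"
  shows "coord_holder \<eta> L h"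
proof -
  have "K * \<bar>s - t\<bar> powr \<eta> \<le> L * \<bar>s - t\<bar> powr \<eta>" for s t
    using assms(2) by (intro mult_right_mono) auto
  note le = order_trans[OF _ this]
  show ?thesis
    using assms(1) unfolding coord_holder_def by (intro ballI conjI le) blast+
qed

lemma exp_decay_Holder:
  assumes "exp_decay T" "0 < \<eta>"
  obtains r where "r \<in> {0<..<1}" "\<And>\<phi> \<psi>. \<phi> \<in> bmeas unif3 \<Longrightarrow> \<psi> \<in> bmeas unif3 \<Longrightarrow>
    \<phi> \<in> Holder \<eta> unit_cube \<Longrightarrow> \<psi> \<in> Holder \<eta> unit_cube \<Longrightarrow> \<exists>C>0. \<forall>n. Cor n T \<phi> \<psi> unif3 \<le> C * r ^ n"
proof -
  obtain r where r: "r \<in> {0<..<1}" and dec: "\<And>\<phi> \<psi> K. \<phi> \<in> bmeas unif3 \<Longrightarrow> \<psi> \<in> bmeas unif3 \<Longrightarrow> K \<ge> 0 \<Longrightarrow>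
      coord_holder \<eta> K \<phi> \<Longrightarrow> coord_holder \<eta> K \<psi> \<Longrightarrow> \<exists>C>0. \<forall>n. Cor n T \<phi> \<psi> unif3 \<le> C * r ^ n"
    using assms unfolding exp_decay_def by meson
  show ?thesis
  proof (rule that[OF r])
    fix \<phi> \<psi> :: "point \<Rightarrow> real"
    assume b: "\<phi> \<in> bmeas unif3" "\<psi> \<in> bmeas unif3"
      and h: "\<phi> \<in> Holder \<eta> unit_cube" "\<psi> \<in> Holder \<eta> unit_cube"
    obtain K where K: "K \<ge> 0" "coord_holder \<eta> K \<phi>" using h(1) by (rule Holder_coord_holder)
    obtain L where L: "L \<ge> 0" "coord_holder \<eta> L \<psi>" using h(2) by (rule Holder_coord_holder)
    show "\<exists>C>0. \<forall>n. Cor n T \<phi> \<psi> unif3 \<le> C * r ^ n"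
      using K(1) by (intro dec[OF b, of "max K L"] coord_holder_mono[OF K(2)] coord_holder_mono[OF L(2)]) simp_all
  qed
qed

text \<open>The projection to the square does not increase distances.\<close>

lemma Holder_fst:
  assumes "h \<in> Holder \<eta> unit_square" "0 < \<eta>"
  shows "(\<lambda>w. h (fst w)) \<in> Holder \<eta> unit_cube"
proof -
  obtain K where K: "K \<ge> 0"
    "\<And>v w. v \<in> unit_square \<Longrightarrow> w \<in> unit_square \<Longrightarrow> \<bar>h v - h w\<bar> \<le> K * dist v w powr \<eta>"
    using assms unfolding Holder_def by blast
  have "\<bar>h (fst v) - h (fst w)\<bar> \<le> K * dist v w powr \<eta>" if "v \<in> unit_cube" "w \<in> unit_cube" for v w
  proof -
    have "\<bar>h (fst v) - h (fst w)\<bar> \<le> K * dist (fst v) (fst w) powr \<eta>"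
      using that by (intro K) (auto simp: unit_cube_def)
    also have "\<dots> \<le> K * dist v w powr \<eta>"
      using K(1) assms(2) by (intro mult_left_mono powr_mono2 dist_fst_le) auto
    finally show ?thesis .
  qed
  then show ?thesis using K(1) by (auto simp: Holder_def)
qed

section \<open>The heterochaos baker maps\<close>

definition branch_x :: "nat \<Rightarrow> real \<Rightarrow> real \<Rightarrow> nat" where
  "branch_x m p x = (if x < p then digit m (x / p) else m)"

text \<open>With \<open>b = 1 / m - a\<close> and \<open>p = m * a\<close>, every \<alpha> maps
  \<open>z\<close> into \<open>[0, p]\<close>, since \<open>1 - m * b = p\<close>; the images of the
  \<beta> branches are stacked above, each of height \<open>b = (1 - p) / m\<close>.\<close>

definition branch_z :: "nat \<Rightarrow> real \<Rightarrow> real \<Rightarrow> nat" where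
  "branch_z m p z = (if z < p then m else digit m ((z - p) / (1 - p)))"

text \<open>One formula covers all pieces: at \<open>i = m\<close> it gives \<open>p\<close>, where
  the \<beta> piece begins.\<close>

definition start_x :: "nat \<Rightarrow> real \<Rightarrow> nat \<Rightarrow> real" where
  "start_x m p i = real i * (p / real m)"

definition start_z :: "nat \<Rightarrow> real \<Rightarrow> nat \<Rightarrow> real" where
  "start_z m p i = (if i = m then 0 else p + real i * ((1 - p) / real m))"

lemma full_branches_x:
  assumes "m > 0" "0 < p" "p < 1"
  shows "full_branches (Suc m) (branch_x m p) (start_x m p) (len m p)"
proof
  show "branch_x m p \<in> borel \<rightarrow>\<^sub>M count_space UNIV"
    unfolding branch_x_def[abs_def] by measurable
  show "branch_x m p x < Suc m" for x
    using digit_less[OF assms(1), of "x / p"] by (auto simp: branch_x_def)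
  fix s assume s: "s < Suc m"
  show "0 < len m p s" "0 \<le> start_x m p s" using assms by (simp_all add: len_def start_x_def)
  have le: "start_x m p s + len m p s \<le> p" if "s < m"
  proof -
    have "(real s + 1) * p \<le> real m * p" using that assms by (intro mult_right_mono) auto
    then show ?thesis using that assms by (simp add: start_x_def field_simps)
  qed
  have m: "start_x m p m = p" using assms by (simp add: start_x_def)
  show "start_x m p s + len m p s \<le> 1"
    using s le m assms by (cases "s = m") auto
  fix x :: real assume x: "x \<in> {0..<1}"
  show "branch_x m p x = s \<longleftrightarrow> start_x m p s \<le> x \<and> x < start_x m p s + len m p s"
  proof (cases "s = m")
    case True
    then show ?thesis using x m digit_less[OF assms(1), of "x / p"] by (auto simp: branch_x_def)
  next
    case False
    then have s: "s < m" using s by simp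
    show ?thesis
    proof (cases "x < p")
      case True
      then have "digit m (x / p) = s \<longleftrightarrow> real s / real m \<le> x / p \<and> x / p < (real s + 1) / real m"
        using x assms s by (intro digit_eq_iff) auto
      then show ?thesis using True s assms by (simp add: branch_x_def start_x_def field_simps)
    next
      case False
      then show ?thesis using s le by (auto simp: branch_x_def)
    qed
  qed
qed

lemma full_branches_z:
  assumes "m > 0" "0 < p" "p < 1"
  shows "full_branches (Suc m) (branch_z m p) (start_z m p) (len m (1 - p))"
proof
  show "branch_z m p \<in> borel \<rightarrow>\<^sub>M count_space UNIV"
    unfolding branch_z_def[abs_def] by measurable
  show "branch_z m p z < Suc m" for z
    using digit_less[OF assms(1), of "(z - p) / (1 - p)"] by (auto simp: branch_z_def)
  fix s assume s: "s < Suc m"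
  show "0 < len m (1 - p) s" "0 \<le> start_z m p s" using assms by (simp_all add: len_def start_z_def)
  show "start_z m p s + len m (1 - p) s \<le> 1"
  proof (cases "s = m")
    case False
    then have "(real s + 1) * ((1 - p) / real m) \<le> real m * ((1 - p) / real m)"
      using s assms by (intro mult_right_mono) auto
    also have "\<dots> = 1 - p" using assms by simp
    finally have "p + (real s + 1) * ((1 - p) / real m) \<le> 1" by simp
    then show ?thesis using s False by (simp add: start_z_def distrib_right add_divide_distrib)
  qed (use assms in \<open>simp add: start_z_def\<close>)
  fix z :: real assume z: "z \<in> {0..<1}"
  show "branch_z m p z = s \<longleftrightarrow> start_z m p s \<le> z \<and> z < start_z m p s + len m (1 - p) s"
  proof (cases "s = m")
    case True
    then show ?thesis
      using z digit_less[OF assms(1), of "(z - p) / (1 - p)"] by (auto simp: branch_z_def start_z_def)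
  next
    case False
    then have s: "s < m" using s by simp
    show ?thesis
    proof (cases "z < p")
      case True
      have "p \<le> start_z m p s" using False assms by (simp add: start_z_def)
      then show ?thesis using True s by (auto simp: branch_z_def)
    next
      case False
      then have "digit m ((z - p) / (1 - p)) = s \<longleftrightarrow>
          real s / real m \<le> (z - p) / (1 - p) \<and> (z - p) / (1 - p) < (real s + 1) / real m"
        using z assms s by (intro digit_eq_iff) auto
      also have "real s / real m \<le> (z - p) / (1 - p) \<longleftrightarrow> start_z m p s \<le> z"
        using s assms by (simp add: start_z_def pos_le_divide_eq) (simp add: algebra_simps)
      also have "(z - p) / (1 - p) < (real s + 1) / real m \<longleftrightarrow> z < start_z m p s + len m (1 - p) s"
        using s assms by (simp add: start_z_def pos_divide_less_eq add_divide_distrib) (simp add: algebra_simps diff_divide_distrib)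
      finally show ?thesis using False by (simp add: branch_z_def)
    qed
  qed
qed

locale heterochaos =
  fixes m :: nat and a :: real
  assumes m_ge: "m \<ge> 2" and a_bounds: "0 < a" "a < 1 / real m"
begin

abbreviation "p \<equiv> real m * a"

lemma m_pos: "m > 0" "real m > 0" using m_ge by auto

lemma p_bounds: "0 < p" "p < 1"
  using a_bounds m_pos by (auto simp: field_simps)

sublocale baker m p "branch_x m p" "start_x m p" "branch_z m p" "start_z m p"
proof -
  have "full_branches (Suc m) (branch_x m p) (start_x m p) (len m p)"
    "full_branches (Suc m) (branch_z m p) (start_z m p) (len m (1 - p))"
    by (rule full_branches_x full_branches_z; use m_pos p_bounds in simp)+
  then show "baker m p (branch_x m p) (start_x m p) (branch_z m p) (start_z m p)"
    using m_ge p_bounds by (simp add: baker_def baker_axioms_def)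
qed

section \<open>Agreement with the heterochaos baker maps\<close>

text \<open>The successor translates pieces counted from 0 into the symbols counted from 1.\<close>

lemma alpha_piece:
  assumes "x \<in> {0..1}" "x < p"
  shows "branch_x m p x < m" "x \<in> {(real (Suc (branch_x m p x)) - 1) * a..<real (Suc (branch_x m p x)) * a}"
proof -
  let ?i = "branch_x m p x"
  show i: "?i < m" using assms digit_less[OF m_pos(1)] by (simp add: branch_x_def)
  have "start_x m p ?i \<le> x \<and> x < start_x m p ?i + len m p ?i"
    using X.br_eq_iff[of ?i x] i assms p_bounds by simp
  then show "x \<in> {(real (Suc ?i) - 1) * a..<real (Suc ?i) * a}"
    using i m_pos by (simp add: start_x_def algebra_simps)
qed

lemma beta_piece:
  assumes "(x, y) \<in> unit_square" "\<not> x < p"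
  shows "(x, y) \<in> Omega_beta_plus m a (Suc (digit m y))" "Suc (digit m y) \<in> {1..m}"
proof -
  have d: "digit m y < m" using m_pos by (simp add: digit_less)
  then show "Suc (digit m y) \<in> {1..m}" by simp
  have y: "0 \<le> y" "y \<le> 1" and x: "p \<le> x" "x \<le> 1" using assms by (auto simp: unit_square_def)
  show "(x, y) \<in> Omega_beta_plus m a (Suc (digit m y))"
  proof (cases "y = 1")
    \<comment> \<open>At \<open>y = 1\<close> the cap in \<open>digit\<close> selects the last
      piece, the only one closed on the right.\<close>
    case True
    then have "Suc (digit m y) = m" using m_pos by (simp add: digit_def)
    then show ?thesis using True x m_pos by (simp add: Omega_beta_plus_def)
  next
    case False
    then have y_piece: "real (digit m y) / real m \<le> y \<and> y < (real (digit m y) + 1) / real m"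
      using digit_eq_iff[OF m_pos(1) d, of y] y by simp
    show ?thesis
    proof (cases "Suc (digit m y) = m")
      case True
      then have "real m - 1 = real (digit m y)" by linarith
      then have "(real m - 1) / real m \<le> y" using y_piece by (simp only:)
      then show ?thesis using True x y by (simp add: Omega_beta_plus_def)
    next
      case False
      then show ?thesis using y_piece x by (simp add: Omega_beta_plus_def add.commute)
    qed
  qed
qed

text \<open>The agreement covers the edges \<open>x = 1\<close> and \<open>y = 1\<close> as well, as
  required for maps of the closed square.\<close>

lemma baker_f_eq:
  assumes "q \<in> unit_square"
  shows "baker_f m a q = f q"
proof -
  obtain x y where q: "q = (x, y)" "x \<in> {0..1}" "y \<in> {0..1}"
    using assms by (auto simp: unit_square_def)
  show ?thesis
  proof (cases "x < p")
    case True
    let ?i = "branch_x m p x"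
    note i = alpha_piece[OF q(2) True]
    have "Suc ?i \<in> {1..m}" using i by simp
    moreover have "(x, y) \<in> Omega_alpha_plus a (Suc ?i)" using i q by (simp add: Omega_alpha_plus_def)
    ultimately show ?thesis
      using i q(1) m_pos baker_f_alpha[OF a_bounds(1), of "Suc ?i" m x y]
        tau_alpha[OF a_bounds(1), of "Suc ?i" m x]
      by (simp add: start_x_def add_divide_distrib)
  next
    case False
    have "branch_x m p x = m" using False by (simp add: branch_x_def)
    moreover have "x \<in> {p..1}" using False q by auto
    ultimately show ?thesis
      using False q assms beta_piece[of x y] baker_f_beta[OF a_bounds(1), of "Suc (digit m y)" m x y]
        tau_beta[OF a_bounds(1), of x m] m_pos
      by (simp add: start_x_def)
  qed
qed

text \<open>For \<open>b = 1 / m - a\<close> the slopes \<open>1 - m * b\<close> and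
  \<open>b\<close> are \<open>p\<close> and \<open>(1 - p) / m\<close>, and the \<beta> offsets
  become \<open>p + i * b\<close> with \<open>i\<close> counted from 0.\<close>

lemma baker_g_eq:
  assumes "w \<in> unit_cube"
  shows "baker_g m a w = g w"
proof -
  obtain x y z where w: "w = ((x, y), z)" "x \<in> {0..1}" "y \<in> {0..1}" "z \<in> {0..1}"
    and xy: "(x, y) \<in> unit_square"
    using assms by (auto simp: unit_cube_def unit_square_def)
  show ?thesis
  proof (cases "x < p")
    case True
    note i = alpha_piece[OF w(2) True]
    have "((x, y), z) \<in> Omega_alpha a (Suc (branch_x m p x))"
      using i w by (simp add: Omega_alpha_def Omega_alpha_plus_def)
    from baker_fab_alpha[OF _ this, of m] i show ?thesis
      using m_pos by (simp add: baker_g_def w(1) baker_f_eq[OF xy] start_z_def algebra_simps)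
  next
    case False
    have br: "branch_x m p x = m" using False by (simp add: branch_x_def)
    have d: "digit m y < m" using m_pos by (simp add: digit_less)
    have "((x, y), z) \<in> Omega_beta m a (Suc (digit m y))"
      using beta_piece[OF xy False] w by (simp add: Omega_beta_def)
    from baker_fab_beta[OF a_bounds(1) beta_piece(2)[OF xy False] this, of "1 / real m - a"]
    have "baker_g m a w = (f (x, y), (1 / real m - a) * z + 1 + (1 / real m - a) * (real (digit m y) - real m))"
      by (simp add: baker_g_def w(1) baker_f_eq[OF xy] algebra_simps)
    also have "(1 / real m - a) * z + 1 + (1 / real m - a) * (real (digit m y) - real m) =
        start_z m p (digit m y) + (1 - p) / real m * z"
      using d m_pos by (simp add: start_z_def field_simps)
    finally show ?thesis using br w(1) by simp
  qed
qed

lemma f_closed: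
  assumes "q \<in> unit_square"
  shows "f q \<in> unit_square"
proof -
  obtain x y where q: "q = (x, y)" "x \<in> {0..1}" "y \<in> {0..1}"
    using assms by (auto simp: unit_square_def)
  show ?thesis
  proof (cases "x < p")
    case True
    note i = alpha_piece[OF q(2) True]
    have "x \<in> {0..<1}" using True q p_bounds by auto
    from X.branch[OF this refl] have "(x - start_x m p (branch_x m p x)) / len m p (branch_x m p x) \<in> {0..1}"
      by auto
    moreover have "real (branch_x m p x) + 1 \<le> real m" using i(1) by linarith
    then have "(y + real (branch_x m p x)) / real m \<in> {0..1}"
      using q m_pos by (simp add: divide_le_eq)
    ultimately show ?thesis using i q(1) by (simp add: unit_square_def)
  next
    case False
    have "branch_x m p x = m" using False by (simp add: branch_x_def)
    moreover have "(x - p) / (1 - p) \<in> {0..1}" using False q p_bounds by (simp add: divide_le_eq)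
    moreover have "real m * y - real (digit m y) \<in> {0..1}"
    proof (cases "y = 1")
      \<comment> \<open>The digit of 1 is \<open>m - 1\<close>, so 1 is sent to 1.\<close>
      case True
      then show ?thesis using m_pos by (simp add: digit_def of_nat_diff)
    next
      case False
      then show ?thesis using digit_shift[OF m_pos(1), of y] q by auto
    qed
    ultimately show ?thesis using q(1) m_pos by (simp add: unit_square_def start_x_def)
  qed
qed

lemma g_closed:
  assumes "w \<in> unit_cube"
  shows "g w \<in> unit_cube"
proof -
  obtain q z where w: "w = (q, z)" "q \<in> unit_square" "z \<in> {0..1}"
    using assms by (auto simp: unit_cube_def)
  have br: "start_z m p s + len m (1 - p) s * z \<in> {0..1}" if "s < Suc m" for s
  proof -
    have "len m (1 - p) s * z \<in> {0..len m (1 - p) s}"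
      using Z.len_pos[OF that] w(3) by (simp add: mult_left_le)
    then show ?thesis using Z.start_nonneg[OF that] Z.end_le[OF that] by simp
  qed
  have d: "digit m y < m" for y using m_pos by (simp add: digit_less)
  have "snd (g w) \<in> {0..1}"
    using br[of m] br[of "digit m (snd q)"] d[of "snd q"] w(1) by (cases q) auto
  then show ?thesis
    using f_closed[OF w(2)] fst_g[of w] w(1) by (simp add: unit_cube_def mem_Times_iff)
qed

lemma mixing_g:
  assumes "p \<noteq> 1 / 2"
  shows "exponentially_mixing (baker_g m a) (restrict_space lborel unit_cube)"
proof (rule exponentially_mixingI[OF compact_unit_cube unif3_density unif3.P.prob_space_axioms _ g_closed baker_g_eq distr_g])
  show "g \<in> borel \<rightarrow>\<^sub>M borel"
    using g_measurable by (simp only: measurable_cong_sets[OF sets_unif3 sets_unif3])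
  fix \<eta> :: real assume "0 < \<eta>"
  show "\<exists>r\<in>{0<..<1}. \<forall>\<phi>\<in>bmeas borel \<inter> Holder \<eta> unit_cube. \<forall>\<psi>\<in>bmeas borel \<inter> Holder \<eta> unit_cube.
      \<exists>B>0. \<forall>n. Cor n g \<phi> \<psi> unif3 \<le> B * r ^ n"
    by (rule exp_decay_Holder[OF exp_decay_g[OF assms] \<open>0 < \<eta>\<close>]) (unfold bmeas_unif3, blast)
qed

lemma mixing_f:
  assumes "p \<noteq> 1 / 2"
  shows "exponentially_mixing (baker_f m a) (restrict_space lborel unit_square)"
proof (rule exponentially_mixingI[OF compact_unit_square unif2_density unif2.P.prob_space_axioms _ f_closed baker_f_eq])
  show "f \<in> borel \<rightarrow>\<^sub>M borel"
    using f_measurable by (simp only: measurable_cong_sets[OF sets_unif2 sets_unif2])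
  have fst_unif3: "distr unif3 unif2 fst = unif2" by (rule unif.distr_pair_fst)
  \<comment> \<open>The projection carries \<open>unif3\<close> to \<open>unif2\<close> and
    intertwines \<open>g\<close> with \<open>f\<close>, so invariance descends.\<close>
  have "distr unif2 unif2 f = distr (distr unif3 unif2 fst) unif2 f" by (simp only: fst_unif3)
  also have "\<dots> = distr (distr unif3 unif3 g) unif2 fst"
    by (simp add: distr_distr comp_def fst_g)
  also have "\<dots> = unif2" by (simp only: distr_g fst_unif3)
  finally show "distr unif2 unif2 f = unif2" .
  fix \<eta> :: real assume \<eta>: "0 < \<eta>"
  obtain r where r: "r \<in> {0<..<1}" "\<And>\<phi> \<psi>. \<phi> \<in> bmeas unif3 \<Longrightarrow> \<psi> \<in> bmeas unif3 \<Longrightarrow>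
    \<phi> \<in> Holder \<eta> unit_cube \<Longrightarrow> \<psi> \<in> Holder \<eta> unit_cube \<Longrightarrow> \<exists>C>0. \<forall>n. Cor n g \<phi> \<psi> unif3 \<le> C * r ^ n"
    using exp_decay_Holder[OF exp_decay_g[OF assms] \<eta>] by blast
  have "\<exists>B>0. \<forall>n. Cor n f \<phi> \<psi> unif2 \<le> B * r ^ n"
    if \<phi>: "\<phi> \<in> bmeas unif2" "\<phi> \<in> Holder \<eta> unit_square" and \<psi>: "\<psi> \<in> bmeas unif2" "\<psi> \<in> Holder \<eta> unit_square" for \<phi> \<psi>
  proof -
    \<comment> \<open>Correlations of the factor are those of \<open>g\<close> for observables
      constant in \<open>z\<close>.\<close>
    have "Cor n f \<phi> \<psi> unif2 = Cor n g (\<lambda>w. \<phi> (fst w)) (\<lambda>w. \<psi> (fst w)) unif3" for n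
    proof -
      have "(\<lambda>q. \<psi> ((f ^^ n) q)) \<in> bmeas unif2" using \<psi>(1) by (rule bmeas_comp) measurable
      from integral_fst_unif3[OF bmeas_mult[OF \<phi>(1) this]] show ?thesis
        by (simp add: Cor_def fst_g_pow integral_fst_unif3 \<phi>(1) \<psi>(1))
    qed
    then show ?thesis
      using r(2)[OF bmeas_fst[OF \<phi>(1)] bmeas_fst[OF \<psi>(1)] Holder_fst[OF \<phi>(2) \<eta>] Holder_fst[OF \<psi>(2) \<eta>]]
      by simp
  qed
  then show "\<exists>r\<in>{0<..<1}. \<forall>\<phi>\<in>bmeas borel \<inter> Holder \<eta> unit_square. \<forall>\<psi>\<in>bmeas borel \<inter> Holder \<eta> unit_square.
      \<exists>B>0. \<forall>n. Cor n f \<phi> \<psi> unif2 \<le> B * r ^ n"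
    using r(1) unfolding bmeas_unif2 by blast
qed

end

theorem theoremB:
  fixes m :: nat and a :: real
  assumes "m \<ge> 2"
    and "a \<in> {0<..<1 / real m} - {1 / (2 * real m)}"
  shows "exponentially_mixing (baker_f m a) (restrict_space lborel unit_square) \<and>
         exponentially_mixing (baker_g m a) (restrict_space lborel unit_cube)"
proof -
  interpret heterochaos m a using assms by unfold_locales auto
  have "real m * a \<noteq> 1 / 2" using assms m_pos by (auto simp: field_simps)
  then show ?thesis using mixing_f mixing_g by blast
qed

end
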